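(* Let $(M,L)$ be a Riemannian space of dimension $n\ge3$ and let $\overline L=f(e^{\sigma}L,\beta)$ be a generalized $\beta$-conformal change with $\lambda\ne0$. Then $(M,\overline L)$ is semi-C-reducible.
   Context: $(M,L)$ is an $n$-dimensional smooth Finsler manifold (Riemannian when $g_{ij}$ does not depend on $y$); $\dot\partial_i=\partial/\partial y^i$, $g_{ij}=\frac12\dot\partial_i\dot\partial_jL^2$, $l_i=\dot\partial_iL$, $y_i=g_{ij}y^j$, $h_{ij}=g_{ij}-l_il_j$, $C_{ijk}=\frac12\dot\partial_kg_{ij}$, $C_i=C_{ijk}g^{jk}$, $C^2=g^{ij}C_iC_j$. A generalized $\beta$-conformal change is $L\mapsto\overline{L}=f(\widetilde L,\beta)$ with $\widetilde L=e^{\sigma(x)}L$, $\sigma$ a smooth function on $M$, $\beta=b_i(x)y^i$ a 1-form, and $f$ smooth and positively homogeneous of degree one in $(\widetilde L,\beta)$; it is assumed that $(M,\overline L)$ is a Finsler space. Barred objects are those of $(M,\overline L)$. Subscripts $1,2$ on $f$ denote partial derivatives with respect to $\widetilde L,\beta$. Put $p=ff_1/L$, $q_0=ff_{22}$, $p_0=f_2^2+q_0$, $p_{-1}=ff_{12}/L+pf_2/f$, $p_{02}=\partial p_0/\partial\beta$, $m_i=b_i-(\beta/L^2)y_i$, $m^2=g^{ij}m_im_j$, $$s_0=\frac{e^{-\sigma}q_0}{p(e^{\sigma}p+m^2q_0)},\qquad \lambda=\frac{(n+1)p_{-1}}{2p}-\frac{3e^{\sigma}p_{-1}m^2s_0}{2}+\frac{p_{02}m^2}{2(e^{\sigma}p+q_0m^2)}.$$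 Standing assumptions at the points under consideration: $m_i\ne0$, $m^2\neq0$, $p\ne0$, $e^{\sigma}p+m^2q_0\neq0$. A Finsler space $(M,L)$ of dimension $n\ge3$ is semi-C-reducible if its Cartan tensor can be written $$C_{ijk}=\frac{r}{n+1}(h_{ij}C_k+h_{ki}C_j+h_{jk}C_i)+\frac{t}{C^2}C_iC_jC_k$$ with scalar functions $r,t$ satisfying $r+t=1$. *)

theory Defs
  imports "HOL-Analysis.Analysis"
begin

primrec Ck_on :: "nat \<Rightarrow> 'a::euclidean_space set \<Rightarrow> ('a \<Rightarrow> 'b::real_normed_vector) \<Rightarrow> bool" where
  "Ck_on 0 S f \<longleftrightarrow> continuous_on S f"
| "Ck_on (Suc k) S f \<longleftrightarrow>
     (\<forall>x\<in>S. f differentiable (at x)) \<and> (\<forall>v. Ck_on k S (\<lambda>x. frechet_derivative f (at x) v))"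

text \<open>Only used for open \<open>S\<close>.\<close>

definition smooth_on :: "'a::euclidean_space set \<Rightarrow> ('a \<Rightarrow> 'b::real_normed_vector) \<Rightarrow> bool" where
  "smooth_on S f \<longleftrightarrow> (\<forall>k. Ck_on k S f)"

text \<open>A chart is a pair \<open>(U, \<phi>)\<close>; the values of \<open>\<phi>\<close> outside \<open>U\<close> are irrelevant. The dimension of
  the manifold is \<open>CARD('n)\<close>, and the set of its points is \<open>topspace X\<close>.\<close>

type_synonym ('m, 'n) chart = "'m set \<times> ('m \<Rightarrow> real^'n)"

definition chart_image :: "('m, 'n::finite) chart \<Rightarrow> (real^'n) set" where
  "chart_image c = snd c ` fst c"

definition chart_inv :: "('m, 'n::finite) chart \<Rightarrow> real^'n \<Rightarrow> 'm" where
  "chart_inv c = inv_into (fst c) (snd c)"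

definition transition :: "('m, 'n::finite) chart \<Rightarrow> ('m, 'n) chart \<Rightarrow> real^'n \<Rightarrow> real^'n" where
  "transition c c' = snd c' \<circ> chart_inv c"

definition smooth_manifold :: "'m topology \<Rightarrow> ('m, 'n::finite) chart set \<Rightarrow> bool" where
  "smooth_manifold X A \<longleftrightarrow>
     Hausdorff_space X \<and> second_countable X \<and>
     \<Union> (fst ` A) = topspace X \<and>
     (\<forall>c\<in>A. openin X (fst c) \<and> open (chart_image c) \<and>
        homeomorphic_map (subtopology X (fst c)) (top_of_set (chart_image c)) (snd c)) \<and>
     (\<forall>c\<in>A. \<forall>c'\<in>A. smooth_on (snd c ` (fst c \<inter> fst c')) (transition c c'))"

definition smooth_scalar :: "('m, 'n::finite) chart set \<Rightarrow> ('m \<Rightarrow> real) \<Rightarrow> bool" where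
  "smooth_scalar A \<sigma> \<longleftrightarrow> (\<forall>c\<in>A. smooth_on (chart_image c) (\<sigma> \<circ> chart_inv c))"

text \<open>A tangent vector is a pair \<open>(p, v)\<close> where \<open>v\<close> assigns to each chart of the atlas around \<open>p\<close> the
  components in that chart; the components in two charts are related by the Jacobian of the
  transition map. To make the representation unique, \<open>v\<close> vanishes on all other charts.\<close>

type_synonym ('m, 'n) tvec = "'m \<times> (('m, 'n) chart \<Rightarrow> real^'n)"

definition tangent_bundle :: "('m, 'n::finite) chart set \<Rightarrow> ('m, 'n) tvec set" where
  "tangent_bundle A = {(p, v). p \<in> \<Union> (fst ` A) \<and>
     (\<forall>c\<in>A. \<forall>c'\<in>A. p \<in> fst c \<longrightarrow> p \<in> fst c' \<longrightarrow>
        v c' = frechet_derivative (transition c c') (at (snd c p)) (v c)) \<and>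
     (\<forall>c. \<not> (c \<in> A \<and> p \<in> fst c) \<longrightarrow> v c = 0)}"

definition slit_tangent_bundle :: "('m, 'n::finite) chart set \<Rightarrow> ('m, 'n) tvec set" where
  "slit_tangent_bundle A = {(p, v) \<in> tangent_bundle A. v \<noteq> (\<lambda>_. 0)}"

text \<open>The tangent vector at \<open>p\<close> with components \<open>y\<close> in the chart \<open>c\<close> (for \<open>c \<in> A\<close>, \<open>p \<in> fst c\<close>).\<close>

definition tvec_of :: "('m, 'n::finite) chart set \<Rightarrow> ('m, 'n) chart \<Rightarrow> 'm \<Rightarrow> real^'n \<Rightarrow> ('m, 'n) tvec" where
  "tvec_of A c p y = (p, \<lambda>c'. if c' \<in> A \<and> p \<in> fst c'
     then frechet_derivative (transition c c') (at (snd c p)) y else 0)"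

text \<open>For \<open>F\<close> on the tangent bundle, \<open>fibre A c F p\<close> is the function \<open>y \<mapsto> F(x, y)\<close> of the fibre
  coordinates of the chart \<open>c\<close>, at fixed \<open>x = snd c p\<close>.\<close>

definition fibre :: "('m, 'n::finite) chart set \<Rightarrow> ('m, 'n) chart \<Rightarrow> (('m, 'n) tvec \<Rightarrow> 'b) \<Rightarrow>
    'm \<Rightarrow> real^'n \<Rightarrow> 'b" where
  "fibre A c F p y = F (tvec_of A c p y)"

definition coord_rep :: "('m, 'n::finite) chart set \<Rightarrow> ('m, 'n) chart \<Rightarrow> (('m, 'n) tvec \<Rightarrow> 'b) \<Rightarrow>
    (real^'n) \<times> (real^'n) \<Rightarrow> 'b" where
  "coord_rep A c F = (\<lambda>(x, y). fibre A c F (chart_inv c x) y)"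

definition coord_domain :: "('m, 'n::finite) chart set \<Rightarrow> ('m, 'n) chart \<Rightarrow> ('m, 'n) tvec set \<Rightarrow>
    ((real^'n) \<times> (real^'n)) set" where
  "coord_domain A c D = {(x, y). x \<in> chart_image c \<and> tvec_of A c (chart_inv c x) y \<in> D}"

definition form_comp :: "('m, 'n::finite) chart set \<Rightarrow> ('m, 'n) chart \<Rightarrow> (('m, 'n) tvec \<Rightarrow> real) \<Rightarrow>
    'm \<Rightarrow> real^'n" where
  "form_comp A c \<beta> p = (\<chi> i. fibre A c \<beta> p (axis i 1))"

definition smooth_one_form :: "('m, 'n::finite) chart set \<Rightarrow> (('m, 'n) tvec \<Rightarrow> real) \<Rightarrow> bool" where
  "smooth_one_form A \<beta> \<longleftrightarrow> (\<forall>c\<in>A.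
     (\<forall>p\<in>fst c. \<forall>y. fibre A c \<beta> p y = (\<Sum>i\<in>UNIV. form_comp A c \<beta> p $ i * y $ i)) \<and>
     smooth_on (chart_image c) (form_comp A c \<beta> \<circ> chart_inv c))"

text \<open>From \<open>g_low\<close> to \<open>C_sq\<close>, \<open>F\<close> stands for the function \<open>y \<mapsto> L(x, y)\<close> in a chart, at a fixed \<open>x\<close>.\<close>

definition pd :: "'n::finite \<Rightarrow> (real^'n \<Rightarrow> real) \<Rightarrow> real^'n \<Rightarrow> real" where
  "pd i F y = deriv (\<lambda>t. F (y + t *\<^sub>R axis i 1)) 0"

definition g_low :: "(real^'n \<Rightarrow> real) \<Rightarrow> real^'n \<Rightarrow> real^'n^'n::finite" where
  "g_low F y = (\<chi> i j. 1/2 * pd i (pd j (\<lambda>z. (F z)\<^sup>2)) y)"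

definition g_up :: "(real^'n \<Rightarrow> real) \<Rightarrow> real^'n \<Rightarrow> real^'n^'n::finite" where
  "g_up F y = matrix_inv (g_low F y)"

definition l_low :: "(real^'n \<Rightarrow> real) \<Rightarrow> real^'n \<Rightarrow> real^'n::finite" where
  "l_low F y = (\<chi> i. pd i F y)"

definition y_low :: "(real^'n \<Rightarrow> real) \<Rightarrow> real^'n \<Rightarrow> real^'n::finite" where
  "y_low F y = (\<chi> i. \<Sum>j\<in>UNIV. g_low F y $ i $ j * y $ j)"

definition h_low :: "(real^'n \<Rightarrow> real) \<Rightarrow> real^'n \<Rightarrow> real^'n^'n::finite" where
  "h_low F y = (\<chi> i j. g_low F y $ i $ j - l_low F y $ i * l_low F y $ j)"

definition C_low :: "(real^'n \<Rightarrow> real) \<Rightarrow> real^'n \<Rightarrow> 'n \<Rightarrow> 'n \<Rightarrow> 'n::finite \<Rightarrow> real" where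
  "C_low F y i j k = 1/2 * pd k (\<lambda>z. g_low F z $ i $ j) y"

definition C_vec :: "(real^'n \<Rightarrow> real) \<Rightarrow> real^'n \<Rightarrow> real^'n::finite" where
  "C_vec F y = (\<chi> i. \<Sum>j\<in>UNIV. \<Sum>k\<in>UNIV. C_low F y i j k * g_up F y $ j $ k)"

definition sq_norm :: "(real^'n \<Rightarrow> real) \<Rightarrow> real^'n \<Rightarrow> real^'n::finite \<Rightarrow> real" where
  "sq_norm F y w = (\<Sum>i\<in>UNIV. \<Sum>j\<in>UNIV. g_up F y $ i $ j * w $ i * w $ j)"

definition C_sq :: "(real^'n::finite \<Rightarrow> real) \<Rightarrow> real^'n \<Rightarrow> real" where
  "C_sq F y = sq_norm F y (C_vec F y)"

text \<open>\<open>D\<close> is an open conic subset of the slit tangent bundle on which the metric lives; the classical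
  case is \<open>D = slit_tangent_bundle A\<close>, smaller \<open>D\<close> accommodate metrics such as those of Kropina. The
  metric tensor is only required to be nondegenerate, which includes the positive definite case.\<close>

definition conic_domain :: "('m, 'n::finite) chart set \<Rightarrow> ('m, 'n) tvec set \<Rightarrow> bool" where
  "conic_domain A D \<longleftrightarrow> D \<subseteq> slit_tangent_bundle A \<and>
     (\<forall>(p, v)\<in>D. \<forall>k>0. (p, \<lambda>c. k *\<^sub>R v c) \<in> D) \<and>
     (\<forall>c\<in>A. open (coord_domain A c D))"

definition finsler :: "('m, 'n::finite) chart set \<Rightarrow> ('m, 'n) tvec set \<Rightarrow> (('m, 'n) tvec \<Rightarrow> real) \<Rightarrow> bool" where
  "finsler A D L \<longleftrightarrow> conic_domain A D \<and>
     (\<forall>v\<in>D. 0 < L v) \<and>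
     (\<forall>(p, v)\<in>D. \<forall>k>0. L (p, \<lambda>c. k *\<^sub>R v c) = k * L (p, v)) \<and>
     (\<forall>c\<in>A. smooth_on (coord_domain A c D) (coord_rep A c L)) \<and>
     (\<forall>v\<in>D. \<forall>c\<in>A. fst v \<in> fst c \<longrightarrow> invertible (g_low (fibre A c L (fst v)) (snd v c)))"

definition riemannian :: "('m, 'n::finite) chart set \<Rightarrow> ('m, 'n) tvec set \<Rightarrow> (('m, 'n) tvec \<Rightarrow> real) \<Rightarrow> bool" where
  "riemannian A D L \<longleftrightarrow> finsler A D L \<and>
     (\<forall>v\<in>D. \<forall>w\<in>D. \<forall>c\<in>A. fst v = fst w \<longrightarrow> fst v \<in> fst c \<longrightarrow>
        g_low (fibre A c L (fst v)) (snd v c) = g_low (fibre A c L (fst w)) (snd w c))"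

text \<open>\<open>E\<close> is the set of points at which the decomposition is required. The scalars \<open>r\<close> and \<open>t\<close> are
  functions on the tangent bundle, i.e. they do not depend on the chart. \<open>C\<^sup>2 \<noteq> 0\<close> is implicit in the
  quotient \<open>t/C\<^sup>2\<close> and has to be required, since division by zero is total.\<close>

definition semi_C_reducible :: "('m, 'n::finite) chart set \<Rightarrow> ('m, 'n) tvec set \<Rightarrow>
    (('m, 'n) tvec \<Rightarrow> real) \<Rightarrow> bool" where
  "semi_C_reducible A E L \<longleftrightarrow> 3 \<le> CARD('n) \<and>
     (\<exists>r t. \<forall>v\<in>E. r v + t v = 1 \<and>
        (\<forall>c\<in>A. fst v \<in> fst c \<longrightarrow>
          (let F = fibre A c L (fst v); y = snd v c; h = h_low F y; C = C_vec F y in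
            C_sq F y \<noteq> 0 \<and>
            (\<forall>i j k. C_low F y i j k =
               r v / (real CARD('n) + 1) * (h $ i $ j * C $ k + h $ k $ i * C $ j + h $ j $ k * C $ i)
               + t v / C_sq F y * C $ i * C $ j * C $ k))))"

definition D1 :: "(real \<Rightarrow> real \<Rightarrow> real) \<Rightarrow> real \<Rightarrow> real \<Rightarrow> real" where
  "D1 f s b = deriv (\<lambda>u. f u b) s"

definition D2 :: "(real \<Rightarrow> real \<Rightarrow> real) \<Rightarrow> real \<Rightarrow> real \<Rightarrow> real" where
  "D2 f s b = deriv (\<lambda>u. f s u) b"

text \<open>\<open>f\<close> need only be defined on an open cone \<open>\<Omega>\<close> of the \<open>(L\<^sub>t, \<beta>)\<close>-plane, where \<open>L\<^sub>t = e\<^sup>\<sigma> L\<close>.\<close>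

definition smooth_homogeneous :: "(real \<times> real) set \<Rightarrow> (real \<Rightarrow> real \<Rightarrow> real) \<Rightarrow> bool" where
  "smooth_homogeneous \<Omega> f \<longleftrightarrow> open \<Omega> \<and> smooth_on \<Omega> (\<lambda>(s, b). f s b) \<and>
     (\<forall>(s, b)\<in>\<Omega>. \<forall>k>0. (k * s, k * b) \<in> \<Omega> \<and> f (k * s) (k * b) = k * f s b)"

definition L_bar :: "(real \<Rightarrow> real \<Rightarrow> real) \<Rightarrow> ('m \<Rightarrow> real) \<Rightarrow> (('m, 'n) tvec \<Rightarrow> real) \<Rightarrow>
    (('m, 'n) tvec \<Rightarrow> real) \<Rightarrow> ('m, 'n) tvec \<Rightarrow> real" where
  "L_bar f \<sigma> \<beta> L v = f (exp (\<sigma> (fst v)) * L v) (\<beta> v)"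

definition gen_beta_conformal_change :: "('m, 'n::finite) chart set \<Rightarrow> ('m, 'n) tvec set \<Rightarrow>
    (real \<times> real) set \<Rightarrow> (real \<Rightarrow> real \<Rightarrow> real) \<Rightarrow> ('m \<Rightarrow> real) \<Rightarrow> (('m, 'n) tvec \<Rightarrow> real) \<Rightarrow>
    (('m, 'n) tvec \<Rightarrow> real) \<Rightarrow> bool" where
  "gen_beta_conformal_change A D \<Omega> f \<sigma> \<beta> L \<longleftrightarrow>
     smooth_scalar A \<sigma> \<and> smooth_one_form A \<beta> \<and> smooth_homogeneous \<Omega> f \<and>
     (\<forall>v\<in>D. (exp (\<sigma> (fst v)) * L v, \<beta> v) \<in> \<Omega>) \<and>
     finsler A D (L_bar f \<sigma> \<beta> L)"

text \<open>The coefficient functions, at real values \<open>s\<close>, \<open>l\<close>, \<open>b\<close>, \<open>m2\<close> of \<open>\<sigma>\<close>, \<open>L\<close>, \<open>\<beta>\<close>, \<open>m\<^sup>2\<close>.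
  \<open>p0_fun\<close> is kept as a function of \<open>(L\<^sub>t, \<beta>)\<close>, to be differentiated in \<open>\<beta>\<close>.\<close>

definition p_coef :: "(real \<Rightarrow> real \<Rightarrow> real) \<Rightarrow> real \<Rightarrow> real \<Rightarrow> real \<Rightarrow> real" where
  "p_coef f s l b = f (exp s * l) b * D1 f (exp s * l) b / l"

definition q0_coef :: "(real \<Rightarrow> real \<Rightarrow> real) \<Rightarrow> real \<Rightarrow> real \<Rightarrow> real \<Rightarrow> real" where
  "q0_coef f s l b = f (exp s * l) b * D2 (D2 f) (exp s * l) b"

definition p0_fun :: "(real \<Rightarrow> real \<Rightarrow> real) \<Rightarrow> real \<Rightarrow> real \<Rightarrow> real" where
  "p0_fun f u b = (D2 f u b)\<^sup>2 + f u b * D2 (D2 f) u b"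

definition p02_coef :: "(real \<Rightarrow> real \<Rightarrow> real) \<Rightarrow> real \<Rightarrow> real \<Rightarrow> real \<Rightarrow> real" where
  "p02_coef f s l b = D2 (p0_fun f) (exp s * l) b"

definition pm1_coef :: "(real \<Rightarrow> real \<Rightarrow> real) \<Rightarrow> real \<Rightarrow> real \<Rightarrow> real \<Rightarrow> real" where
  "pm1_coef f s l b = f (exp s * l) b * D2 (D1 f) (exp s * l) b / l
     + p_coef f s l b * D2 f (exp s * l) b / f (exp s * l) b"

definition s0_coef :: "(real \<Rightarrow> real \<Rightarrow> real) \<Rightarrow> real \<Rightarrow> real \<Rightarrow> real \<Rightarrow> real \<Rightarrow> real" where
  "s0_coef f s l b m2 = exp (- s) * q0_coef f s l b /
     (p_coef f s l b * (exp s * p_coef f s l b + m2 * q0_coef f s l b))"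

definition lambda_coef :: "nat \<Rightarrow> (real \<Rightarrow> real \<Rightarrow> real) \<Rightarrow> real \<Rightarrow> real \<Rightarrow> real \<Rightarrow> real \<Rightarrow> real" where
  "lambda_coef n f s l b m2 =
     (real n + 1) * pm1_coef f s l b / (2 * p_coef f s l b)
     - 3 * exp s * pm1_coef f s l b * m2 * s0_coef f s l b m2 / 2
     + p02_coef f s l b * m2 / (2 * (exp s * p_coef f s l b + q0_coef f s l b * m2))"

text \<open>The components \<open>m\<^sub>i\<close> and the scalar \<open>m\<^sup>2\<close> at the tangent vector \<open>v\<close>, computed in the chart \<open>c\<close>
  with the unbarred metric.\<close>

definition m_low :: "('m, 'n::finite) chart set \<Rightarrow> ('m, 'n) chart \<Rightarrow> (('m, 'n) tvec \<Rightarrow> real) \<Rightarrow>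
    (('m, 'n) tvec \<Rightarrow> real) \<Rightarrow> ('m, 'n) tvec \<Rightarrow> real^'n" where
  "m_low A c \<beta> L v = (\<chi> i. form_comp A c \<beta> (fst v) $ i
     - \<beta> v / (L v)\<^sup>2 * y_low (fibre A c L (fst v)) (snd v c) $ i)"

definition m_sq :: "('m, 'n::finite) chart set \<Rightarrow> ('m, 'n) chart \<Rightarrow> (('m, 'n) tvec \<Rightarrow> real) \<Rightarrow>
    (('m, 'n) tvec \<Rightarrow> real) \<Rightarrow> ('m, 'n) tvec \<Rightarrow> real" where
  "m_sq A c \<beta> L v = sq_norm (fibre A c L (fst v)) (snd v c) (m_low A c \<beta> L v)"

definition regular_point :: "('m, 'n::finite) chart set \<Rightarrow> ('m, 'n) chart \<Rightarrow>
    (real \<Rightarrow> real \<Rightarrow> real) \<Rightarrow> ('m \<Rightarrow> real) \<Rightarrow> (('m, 'n) tvec \<Rightarrow> real) \<Rightarrow>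
    (('m, 'n) tvec \<Rightarrow> real) \<Rightarrow> ('m, 'n) tvec \<Rightarrow> bool" where
  "regular_point A c f \<sigma> \<beta> L v \<longleftrightarrow>
     (let s = \<sigma> (fst v); m2 = m_sq A c \<beta> L v;
          p = p_coef f s (L v) (\<beta> v); q0 = q0_coef f s (L v) (\<beta> v) in
       m_low A c \<beta> L v \<noteq> 0 \<and> m2 \<noteq> 0 \<and> p \<noteq> 0 \<and> exp s * p + m2 * q0 \<noteq> 0)"

end

theory Submission
  imports Defs
begin

text \<open>
  Fix a point of the manifold and a chart around it. A Riemannian \<open>L\<close> restricted to the fibre is the
  square root of a quadratic form: \<open>L\<^sup>2\<close> is homogeneous of degree two with a constant Hessian, so two
  applications of Euler's theorem give \<open>L\<^sup>2 = g\<^sub>i\<^sub>j y\<^sup>i y\<^sup>j\<close>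
  (\<open>constant_hessian_imp_quadratic_form\<close>). Since \<open>f\<close> is homogeneous of degree one, it is determined by
  the function \<open>\<phi> = f(1, -)\<close> of one variable. With the conformal metric \<open>G = e\<^sup>2\<^sup>\<sigma> g\<close>, with
  \<open>u = sqrt (G\<^sub>i\<^sub>j y\<^sup>i y\<^sup>j)\<close> and with \<open>\<tau> = \<beta>/u\<close>, the changed metric is therefore \<open>u \<phi>(\<tau>)\<close> with \<open>u\<close>
  explicit and \<open>\<beta>\<close> linear, and everything can be differentiated along coordinate lines.

  The key is that the gradient of \<open>\<tau>\<close> is \<open>m/u\<close>. Hence the angular metric and the Cartan tensor of the
  changed metric are combinations of the angular metric \<open>h\<close> of \<open>G\<close> and of the covector \<open>m\<close> alone:
  \<open>h\<close> turns into \<open>a h\<^sub>i\<^sub>j + q m\<^sub>i m\<^sub>j\<close>, and the Cartan tensor, which vanishes for \<open>G\<close>, turns into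
  \<open>\<alpha> (h\<^sub>i\<^sub>j m\<^sub>k + h\<^sub>k\<^sub>i m\<^sub>j + h\<^sub>j\<^sub>k m\<^sub>i) + \<gamma> m\<^sub>i m\<^sub>j m\<^sub>k\<close> (\<open>h_low_formula\<close>, \<open>C_low_formula\<close>).
  All these tensors are annihilated by \<open>y\<close>, and on covectors with this property the inverse of the new
  metric is that of a rank one perturbation of \<open>a h\<close>. Contracting shows that the mean Cartan tensor is
  \<open>\<lambda> m\<close> and that its square norm is a nonzero multiple of \<open>\<lambda>\<^sup>2\<close> (\<open>contraction\<close>, \<open>m_w\<close>). As
  \<open>\<lambda> \<noteq> 0\<close>, the covector \<open>m\<close> can be replaced by the mean Cartan tensor and \<open>h\<close> by the new angular
  metric, which is the required decomposition with \<open>r = (n + 1) p\<^sub>-\<^sub>1 / (2 p \<lambda>)\<close>; the identity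
  \<open>r + t = 1\<close> is the definition of \<open>\<lambda>\<close> (\<open>semi_C_reducible_fibre\<close>).

  Finally \<open>r\<close> must not depend on the chart. It does so only through \<open>m\<^sup>2\<close>, and the Jacobian of a
  transition map is an isometry between the quadratic forms of the two charts that pulls \<open>m\<close> back to
  \<open>m\<close> (\<open>m_sq_chart_invariant\<close>).
\<close>

section \<open>Smooth functions\<close>

lemma Ck_on_cong:
  assumes "open S" and "\<And>x. x \<in> S \<Longrightarrow> f x = g x"
  shows "Ck_on k S f \<longleftrightarrow> Ck_on k S g"
  using assms(2)
proof (induction k arbitrary: f g)
  case 0
  then show ?case by (simp cong: continuous_on_cong)
next
  case (Suc k)
  have d: "(f has_derivative f') (at x) \<longleftrightarrow> (g has_derivative f') (at x)" if "x \<in> S" for x f'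
    using has_derivative_transform_within_open[OF _ assms(1) that, of f f' UNIV g]
      has_derivative_transform_within_open[OF _ assms(1) that, of g f' UNIV f] Suc.prems by auto
  have "f differentiable (at x) \<longleftrightarrow> g differentiable (at x)" if "x \<in> S" for x
    using d[OF that] by (simp add: differentiable_def)
  moreover have "frechet_derivative f (at x) = frechet_derivative g (at x)" if "x \<in> S" for x
    using d[OF that] by (simp add: frechet_derivative_def)
  then have "Ck_on k S (\<lambda>x. frechet_derivative f (at x) v)
      \<longleftrightarrow> Ck_on k S (\<lambda>x. frechet_derivative g (at x) v)" for v
    by (intro Suc.IH) simp
  ultimately show ?case by simp
qed

lemma smooth_on_cong:
  assumes "open S" and "\<And>x. x \<in> S \<Longrightarrow> f x = g x"
  shows "smooth_on S f \<longleftrightarrow> smooth_on S g"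
  using Ck_on_cong[OF assms] by (simp add: smooth_on_def)

lemma smooth_on_has_derivative:
  assumes "smooth_on S f" and "x \<in> S"
  shows "(f has_derivative frechet_derivative f (at x)) (at x)"
proof -
  have "Ck_on (Suc 0) S f" using assms(1) by (simp only: smooth_on_def)
  then show ?thesis using assms(2) by (simp add: frechet_derivative_works)
qed

lemma smooth_on_frechet_derivative:
  assumes "smooth_on S f"
  shows "smooth_on S (\<lambda>x. frechet_derivative f (at x) v)"
proof -
  have "Ck_on (Suc k) S f" for k using assms by (simp only: smooth_on_def)
  then show ?thesis by (simp add: smooth_on_def)
qed

section \<open>Partial derivatives and homogeneous functions\<close>

lemma pd_eqI:
  assumes "((\<lambda>s. F (y + s *\<^sub>R axis i 1)) has_real_derivative d) (at 0)"
  shows "pd i F y = d"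
  using assms by (simp add: pd_def DERIV_imp_deriv)

lemma eventually_line_in_open:
  fixes y :: "real^'n::finite"
  assumes "open U" and "y \<in> U"
  shows "\<forall>\<^sub>F s in nhds 0. y + s *\<^sub>R axis i 1 \<in> U"
proof -
  have "open ((\<lambda>s::real. y + s *\<^sub>R axis i 1) -` U)"
    by (intro open_vimage assms(1) continuous_intros)
  then show ?thesis
    using assms(2) by (auto simp: eventually_nhds intro!: exI[of _ "(\<lambda>s::real. y + s *\<^sub>R axis i 1) -` U"])
qed

lemma pd_cong:
  assumes "open U" and "y \<in> U" and "\<And>z. z \<in> U \<Longrightarrow> F z = G z"
  shows "pd i F y = pd i G y"
  unfolding pd_def
  by (rule deriv_cong_ev[OF eventually_mono[OF eventually_line_in_open[OF assms(1,2), of i]] refl])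
     (simp add: assms(3))

text \<open>The form in which partial derivatives are computed below: a closed formula for the function is
  needed on a neighbourhood only, and the formula is differentiated along a coordinate line.\<close>

lemma pd_eqI_open:
  assumes "open U" and "y \<in> U" and "\<And>z. z \<in> U \<Longrightarrow> F z = G z"
    and "((\<lambda>s. G (y + s *\<^sub>R axis i 1)) has_real_derivative d) (at 0)"
  shows "pd i F y = d"
  using pd_cong[OF assms(1-3)] pd_eqI[of G, OF assms(4)] by simp

lemma has_derivative_along_line:
  fixes F :: "real^'n::finite \<Rightarrow> real"
  assumes "(F has_derivative F') (at y)"
  shows "((\<lambda>s. F (y + s *\<^sub>R v)) has_real_derivative F' v) (at 0)"
proof -
  have F: "(F has_derivative F') (at (y + 0 *\<^sub>R v))" using assms by simp
  have "((\<lambda>s::real. y + s *\<^sub>R v) has_derivative (\<lambda>s. s *\<^sub>R v)) (at 0)"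
    by (auto intro!: derivative_eq_intros)
  from has_derivative_compose[OF this F]
  have "((\<lambda>s. F (y + s *\<^sub>R v)) has_derivative (\<lambda>s. F' (s *\<^sub>R v))) (at 0)" .
  moreover have "(\<lambda>s. F' (s *\<^sub>R v)) = (*) (F' v)"
    using linear_cmul[OF has_derivative_linear[OF assms]] by (simp add: fun_eq_iff)
  ultimately show ?thesis by (simp add: has_field_derivative_def)
qed

lemma pd_has_derivative:
  assumes "(F has_derivative F') (at y)"
  shows "pd i F y = F' (axis i 1)"
  by (rule pd_eqI has_derivative_along_line assms)+

lemma has_derivative_eq_sum_pd:
  fixes F :: "real^'n::finite \<Rightarrow> real"
  assumes "(F has_derivative F') (at y)"
  shows "F' v = (\<Sum>i\<in>UNIV. v $ i * pd i F y)"
proof -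
  have lin: "linear F'" using assms by (rule has_derivative_linear)
  have "F' v = F' (\<Sum>i\<in>UNIV. (v $ i) *\<^sub>R axis i 1)"
    using basis_expansion[of v] by (simp add: scalar_mult_eq_scaleR)
  also have "\<dots> = (\<Sum>i\<in>UNIV. v $ i * F' (axis i 1))"
    by (simp add: linear_sum[OF lin] linear_cmul[OF lin])
  finally show ?thesis by (simp add: pd_has_derivative[OF assms])
qed

text \<open>Both sides are the derivative of \<open>s \<mapsto> F ((1 + s) y)\<close> at \<open>s = 0\<close>.\<close>

lemma Euler_homogeneous:
  fixes F :: "real^'n::finite \<Rightarrow> real"
  assumes "F differentiable (at y)" and hom: "\<And>k. 0 < k \<Longrightarrow> F (k *\<^sub>R y) = k ^ r * F y"
  shows "(\<Sum>i\<in>UNIV. y $ i * pd i F y) = real r * F y"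
proof -
  obtain F' where F': "(F has_derivative F') (at y)" using assms(1) by (auto simp: differentiable_def)
  have "((\<lambda>s. F (y + s *\<^sub>R y)) has_real_derivative F' y) (at 0)"
    by (rule has_derivative_along_line[OF F'])
  moreover have "((\<lambda>s. F (y + s *\<^sub>R y)) has_real_derivative real r * F y) (at 0)"
  proof (rule DERIV_cong_ev[THEN iffD2, OF refl _ refl])
    have "\<forall>\<^sub>F s in nhds (0::real). -1 < s"
      using eventually_nhds_in_open[of "{-1<..}" "0::real"] by simp
    then show "\<forall>\<^sub>F s in nhds 0. F (y + s *\<^sub>R y) = (1 + s) ^ r * F y"
    proof (rule eventually_mono)
      fix s :: real assume "-1 < s"
      then show "F (y + s *\<^sub>R y) = (1 + s) ^ r * F y" 
        using hom[of "1 + s"] by (simp add: scaleR_add_left)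
    qed
    show "((\<lambda>s. (1 + s) ^ r * F y) has_real_derivative real r * F y) (at 0)"
      by (auto intro!: derivative_eq_intros)
  qed
  ultimately have "F' y = real r * F y" by (rule DERIV_unique)
  then show ?thesis by (simp add: has_derivative_eq_sum_pd[OF F'])
qed

lemma pd_homogeneous:
  fixes F :: "real^'n::finite \<Rightarrow> real"
  assumes "open U" and cone: "\<And>z k. z \<in> U \<Longrightarrow> 0 < k \<Longrightarrow> k *\<^sub>R z \<in> U"
    and diff: "\<And>z. z \<in> U \<Longrightarrow> F differentiable (at z)"
    and hom: "\<And>z k. z \<in> U \<Longrightarrow> 0 < k \<Longrightarrow> F (k *\<^sub>R z) = k ^ Suc r * F z"
    and "y \<in> U" and "0 < k"
  shows "pd i F (k *\<^sub>R y) = k ^ r * pd i F y"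
proof -
  obtain F' where F': "(F has_derivative F') (at y)"
    using diff[OF \<open>y \<in> U\<close>] by (auto simp: differentiable_def)
  obtain F'' where F'': "(F has_derivative F'') (at (k *\<^sub>R y))"
    using diff[OF cone[OF \<open>y \<in> U\<close> \<open>0 < k\<close>]] by (auto simp: differentiable_def)
  have "((\<lambda>z. k *\<^sub>R z) has_derivative (\<lambda>z. k *\<^sub>R z)) (at y)"
    by (auto intro!: derivative_eq_intros)
  from has_derivative_compose[OF this F'']
  have 1: "((\<lambda>z. F (k *\<^sub>R z)) has_derivative (\<lambda>z. F'' (k *\<^sub>R z))) (at y)" .
  have "((\<lambda>z. k ^ Suc r * F z) has_derivative (\<lambda>z. k ^ Suc r * F' z)) (at y)"
    by (rule has_derivative_mult_right[OF F'])
  then have 2: "((\<lambda>z. F (k *\<^sub>R z)) has_derivative (\<lambda>z. k ^ Suc r * F' z)) (at y)"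
    by (rule has_derivative_transform_within_open[OF _ \<open>open U\<close> \<open>y \<in> U\<close>])
       (simp add: hom \<open>0 < k\<close>)
  have "F'' (k *\<^sub>R axis i 1) = k ^ Suc r * F' (axis i 1)"
    using has_derivative_unique[OF 1 2] by meson
  then have "k * F'' (axis i 1) = k * (k ^ r * F' (axis i 1))"
    using linear_cmul[OF has_derivative_linear[OF F'']] by simp
  then show ?thesis
    using \<open>0 < k\<close> by (simp add: pd_has_derivative[OF F'] pd_has_derivative[OF F''])
qed

lemma inner_line:
  fixes b z :: "real^'n::finite"
  shows "((\<lambda>s. b \<bullet> (z + s *\<^sub>R axis i 1)) has_real_derivative b $ i) (at 0)"
  by (auto intro!: derivative_eq_intros simp: inner_add_right inner_axis)

lemma matrix_line:
  fixes z :: "real^'n::finite" and g :: "real^'n^'n"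
  shows "((\<lambda>s. (g *v (z + s *\<^sub>R axis i 1)) $ j) has_real_derivative g $ j $ i) (at 0)"
  using inner_line[of "row j g" z i] by (simp add: matrix_vector_mul_component row_def)

lemma quadratic_line:
  fixes z :: "real^'n::finite" and g :: "real^'n^'n"
  assumes sym: "transpose g = g"
  shows "((\<lambda>s. (z + s *\<^sub>R axis i 1) \<bullet> (g *v (z + s *\<^sub>R axis i 1)))
    has_real_derivative 2 * (g *v z) $ i) (at 0)"
proof -
  let ?e = "axis i 1 :: real^'n"
  have [simp]: "?e \<bullet> (g *v z) = (g *v z) $ i" "z \<bullet> (g *v ?e) = (g *v z) $ i"
    using dot_lmul_matrix[of z g ?e] vector_transpose_matrix[of z g] sym
    by (simp_all add: inner_axis' inner_axis)
  have "(z + s *\<^sub>R ?e) \<bullet> (g *v (z + s *\<^sub>R ?e))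
      = z \<bullet> (g *v z) + 2 * s * (g *v z) $ i + s\<^sup>2 * (?e \<bullet> (g *v ?e))" for s
    by (simp add: matrix_vector_right_distrib matrix_vector_mult_scaleR inner_add_left inner_add_right
        algebra_simps power2_eq_square)
  then show ?thesis
    by (auto intro!: derivative_eq_intros)
qed

text \<open>This is where the independence of \<open>g\<^sub>i\<^sub>j\<close> from \<open>y\<close> enters. The partial derivatives of \<open>q\<close> are
  homogeneous of degree one, so that Euler's theorem for them and then for \<open>q\<close> itself integrates the
  Hessian twice. Symmetry follows by differentiating the quadratic form obtained: its Hessian is
  \<open>g + g\<^sup>T\<close>, but also \<open>2 g\<close>.\<close>

lemma constant_hessian_imp_quadratic_form:
  fixes q :: "real^'n::finite \<Rightarrow> real" and g :: "real^'n^'n"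
  assumes U: "open U" and cone: "\<And>z k. z \<in> U \<Longrightarrow> 0 < k \<Longrightarrow> k *\<^sub>R z \<in> U"
    and hom: "\<And>z k. z \<in> U \<Longrightarrow> 0 < k \<Longrightarrow> q (k *\<^sub>R z) = k\<^sup>2 * q z"
    and d1: "\<And>z. z \<in> U \<Longrightarrow> q differentiable (at z)"
    and d2: "\<And>z j. z \<in> U \<Longrightarrow> pd j q differentiable (at z)"
    and hess: "\<And>z i j. z \<in> U \<Longrightarrow> pd i (pd j q) z = 2 * g $ i $ j"
    and "y \<in> U"
  shows "q y = y \<bullet> (g *v y)" and "transpose g = g"
proof -
  have q1: "pd j q z = 2 * (\<Sum>i\<in>UNIV. z $ i * g $ i $ j)" if "z \<in> U" for z j
    using Euler_homogeneous[where r = 1, OF d2[OF that]]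
      pd_homogeneous[where r = 1, OF U cone d1 _ that] hom hess[OF that]
    by (simp add: sum_distrib_left algebra_simps numeral_2_eq_2)
  have q0: "q z = z \<bullet> (g *v z)" if "z \<in> U" for z
  proof -
    have "2 * q z = (\<Sum>j\<in>UNIV. z $ j * pd j q z)"
      using Euler_homogeneous[where r = 2, OF d1[OF that]] hom[OF that] by simp
    also have "\<dots> = 2 * (\<Sum>j\<in>UNIV. \<Sum>i\<in>UNIV. z $ i * (g $ i $ j * z $ j))"
      by (simp add: q1[OF that] sum_distrib_left algebra_simps)
    also have "\<dots> = 2 * (z \<bullet> (g *v z))"
      by (subst sum.swap) (simp add: inner_vec_def matrix_vector_mult_def sum_distrib_left)
    finally show ?thesis by simp
  qed
  show "q y = y \<bullet> (g *v y)" by (rule q0[OF \<open>y \<in> U\<close>])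
  have "2 * g $ i $ j = g $ i $ j + g $ j $ i" for i j
  proof -
    let ?S = "g + transpose g"
    have S: "z \<bullet> (g *v z) = (1/2) * (z \<bullet> (?S *v z))" for z
      using dot_lmul_matrix[of z g z] 
      by (simp add: matrix_vector_mult_add_rdistrib inner_add_right inner_commute)
    have "transpose ?S = ?S" by (simp add: transpose_def vec_eq_iff)
    then have "((\<lambda>s. (1/2) * ((z + s *\<^sub>R axis j 1) \<bullet> (?S *v (z + s *\<^sub>R axis j 1))))
        has_real_derivative (?S *v z) $ j) (at 0)" for z
      using DERIV_cmult[OF quadratic_line[of ?S z j], of "1/2"] by simp
    then have "pd j q z = (?S *v z) $ j" if "z \<in> U" for z
      by (intro pd_eqI_open[OF U that q0[unfolded S]])
    from pd_eqI_open[OF U \<open>y \<in> U\<close> this matrix_line]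
    show ?thesis using hess[OF \<open>y \<in> U\<close>] by (simp add: transpose_def)
  qed
  then show "transpose g = g" by (simp add: transpose_def vec_eq_iff)
qed

text \<open>Smoothness on the total space passes to a fibre, also for the partial derivatives along the fibre.\<close>

lemma smooth_on_slice:
  fixes H :: "(real^'n::finite) \<times> (real^'n) \<Rightarrow> real"
  assumes H: "smooth_on W H" and "open W" and z: "(x, z) \<in> W"
  shows "(\<lambda>z. H (x, z)) differentiable (at z)"
    and "pd j (\<lambda>z. H (x, z)) differentiable (at z)"
proof -
  have slice: "((\<lambda>z. K (x, z)) has_derivative (\<lambda>v. frechet_derivative K (at (x, z)) (0, v))) (at z)"
    if "smooth_on W K" "(x, z) \<in> W" for K :: "(real^'n) \<times> (real^'n) \<Rightarrow> real" and z
    by (rule has_derivative_compose[OF has_derivative_Pair[OF has_derivative_const has_derivative_ident]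
          smooth_on_has_derivative[OF that]])
  show "(\<lambda>z. H (x, z)) differentiable (at z)"
    by (rule differentiableI[OF slice[OF H z]])
  let ?K = "\<lambda>w. frechet_derivative H (at w) (0, axis j 1)"
  have "open ((\<lambda>z. (x, z)) -` W)"
    by (intro open_vimage \<open>open W\<close> continuous_intros)
  moreover have "pd j (\<lambda>z. H (x, z)) z = ?K (x, z)" if "(x, z) \<in> W" for z
    by (rule pd_has_derivative[OF slice[OF H that]])
  ultimately have "(pd j (\<lambda>z. H (x, z)) has_derivative
      (\<lambda>v. frechet_derivative ?K (at (x, z)) (0, v))) (at z)"
    using has_derivative_transform_within_open[OF slice[OF smooth_on_frechet_derivative[OF H] z, of "(0, axis j 1)"],
        of "(\<lambda>z. (x, z)) -` W" "pd j (\<lambda>z. H (x, z))"] z by simp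
  then show "pd j (\<lambda>z. H (x, z)) differentiable (at z)"
    by (rule differentiableI)
qed

section \<open>The fibrewise geometry of the changed metric\<close>

text \<open>The changed metric in one fibre. \<open>G\<close> is the Riemannian metric after the conformal factor has been
  absorbed, and the change \<open>f\<close> is given by its restriction \<open>\<phi>\<close> to the line where the first
  argument is one, together with three derivatives of \<open>\<phi>\<close>, as many as the Cartan tensor requires.\<close>

locale beta_change_of_quadratic =
  fixes U :: "(real^'n::finite) set" and G :: "real^'n^'n" and b :: "real^'n"
    and \<phi> \<phi>1 \<phi>2 \<phi>3 :: "real \<Rightarrow> real" and T :: "real set" and Fb :: "real^'n \<Rightarrow> real"
  assumes U: "open U"
    and sym: "transpose G = G"
    and pos: "z \<in> U \<Longrightarrow> 0 < z \<bullet> (G *v z)"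
    and der: "\<tau> \<in> T \<Longrightarrow> (\<phi> has_real_derivative \<phi>1 \<tau>) (at \<tau>)"
      "\<tau> \<in> T \<Longrightarrow> (\<phi>1 has_real_derivative \<phi>2 \<tau>) (at \<tau>)"
      "\<tau> \<in> T \<Longrightarrow> (\<phi>2 has_real_derivative \<phi>3 \<tau>) (at \<tau>)"
    and T: "z \<in> U \<Longrightarrow> b \<bullet> z / sqrt (z \<bullet> (G *v z)) \<in> T"
    and Fb: "z \<in> U \<Longrightarrow> Fb z = sqrt (z \<bullet> (G *v z)) * \<phi> (b \<bullet> z / sqrt (z \<bullet> (G *v z)))"
begin

definition u :: "real^'n \<Rightarrow> real" where "u z = sqrt (z \<bullet> (G *v z))"
definition \<tau> :: "real^'n \<Rightarrow> real" where "\<tau> z = b \<bullet> z / u z"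
definition Y :: "real^'n \<Rightarrow> real^'n" where "Y z = G *v z"
definition m :: "real^'n \<Rightarrow> real^'n" where "m z = b - (\<tau> z / u z) *\<^sub>R Y z"
definition h :: "real^'n \<Rightarrow> 'n \<Rightarrow> 'n \<Rightarrow> real" where
  "h z i j = G $ i $ j - Y z $ i * Y z $ j / (u z)\<^sup>2"

text \<open>Put \<open>\<Psi> = \<phi>\<^sup>2/2\<close>, so that \<open>Fb\<^sup>2/2 = u\<^sup>2 \<Psi>(\<tau>)\<close>. Then \<open>a0 = 2\<Psi> - \<tau>\<Psi>'\<close>, \<open>a1\<close> is its derivative,
  \<open>c0 = \<Psi>''\<close> and \<open>c1 = \<Psi>'''\<close>. In terms of the coefficients of the change, \<open>a0 = e\<^sup>-\<^sup>\<sigma> p\<close>,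
  \<open>a1 = L p\<^sub>-\<^sub>1\<close>, \<open>c0 = p\<^sub>0\<close> and \<open>c1 = u p\<^sub>0\<^sub>2\<close>.\<close>

definition a0 :: "real \<Rightarrow> real" where "a0 x = \<phi> x * (\<phi> x - x * \<phi>1 x)"
definition a1 :: "real \<Rightarrow> real" where "a1 x = \<phi> x * \<phi>1 x - x * ((\<phi>1 x)\<^sup>2 + \<phi> x * \<phi>2 x)"
definition c0 :: "real \<Rightarrow> real" where "c0 x = (\<phi>1 x)\<^sup>2 + \<phi> x * \<phi>2 x"
definition c1 :: "real \<Rightarrow> real" where "c1 x = 3 * \<phi>1 x * \<phi>2 x + \<phi> x * \<phi>3 x"

lemma u_pos: "z \<in> U \<Longrightarrow> 0 < u z"
  by (simp add: u_def pos)

text \<open>The argument \<open>z + 0 *\<^sub>R v\<close> is the form in which differentiation rules at parameter zero leave the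
  base point.\<close>

lemma u_nonzero_0: "z \<in> U \<Longrightarrow> u (z + 0 *\<^sub>R v) \<noteq> 0"
  using u_pos[of z] by simp

text \<open>Substituting this for \<open>b\<close> is what turns the formulas in \<open>b\<close> and \<open>Y\<close>, which are easy to
  differentiate, into formulas in \<open>m\<close> and \<open>Y\<close>, which are geometric.\<close>

lemma b_component: "b $ i = m z $ i + (\<tau> z / u z) * Y z $ i"
  by (simp add: m_def)

lemma Y_line: "((\<lambda>s. Y (z + s *\<^sub>R axis i 1) $ j) has_real_derivative G $ j $ i) (at 0)"
  unfolding Y_def by (rule matrix_line)

lemma u_line:
  assumes "z \<in> U"
  shows "((\<lambda>s. u (z + s *\<^sub>R axis i 1)) has_real_derivative Y z $ i / u z) (at 0)"
  unfolding u_def Y_def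
  by (rule DERIV_cong[OF DERIV_chain2[OF DERIV_real_sqrt quadratic_line[OF sym]]])
     (use pos[OF assms] in \<open>simp_all add: divide_simps\<close>)

lemma \<tau>_line:
  assumes "z \<in> U"
  shows "((\<lambda>s. \<tau> (z + s *\<^sub>R axis i 1)) has_real_derivative m z $ i / u z) (at 0)"
proof -
  have "((\<lambda>s. \<tau> (z + s *\<^sub>R axis i 1)) has_real_derivative
      (b $ i * u z - (b \<bullet> z) * (Y z $ i / u z)) / (u z * u z)) (at 0)"
    unfolding \<tau>_def
    using DERIV_divide[OF inner_line[of b z i] u_line[OF assms, of i]] u_pos[OF assms] by simp
  moreover have "(b $ i * u z - (b \<bullet> z) * (Y z $ i / u z)) / (u z * u z) = m z $ i / u z"
    using u_pos[OF assms] by (simp add: m_def \<tau>_def field_simps power2_eq_square)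
  ultimately show ?thesis by simp
qed

lemma compose_\<tau>_line:
  assumes "z \<in> U" and "(\<psi> has_real_derivative d) (at (\<tau> z))"
  shows "((\<lambda>s. \<psi> (\<tau> (z + s *\<^sub>R axis i 1))) has_real_derivative d * (m z $ i / u z)) (at 0)"
  using DERIV_chain2[OF _ \<tau>_line[OF assms(1), of i], of \<psi> d] assms(2) by simp

lemma \<tau>_in_T: "z \<in> U \<Longrightarrow> \<tau> z \<in> T"
  using T by (simp add: \<tau>_def u_def)

lemma a0_der: "x \<in> T \<Longrightarrow> (a0 has_real_derivative a1 x) (at x)"
  unfolding a0_def [abs_def] a1_def
  by (auto intro!: derivative_eq_intros der simp: algebra_simps power2_eq_square)

text \<open>The derivative of \<open>a1 = \<Psi>' - \<tau>\<Psi>''\<close> is \<open>-\<tau>\<Psi>'''\<close>, so that \<open>c1\<close> is the only new function in the Cartan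
  tensor.\<close>

lemma a1_der: "x \<in> T \<Longrightarrow> (a1 has_real_derivative - (x * c1 x)) (at x)"
  unfolding a1_def [abs_def] c1_def
  by (auto intro!: derivative_eq_intros der simp: algebra_simps power2_eq_square)

lemma c0_der: "x \<in> T \<Longrightarrow> (c0 has_real_derivative c1 x) (at x)"
  unfolding c0_def [abs_def] c1_def
  by (auto intro!: derivative_eq_intros der simp: algebra_simps power2_eq_square)

lemmas line_intros = u_line \<tau>_line Y_line compose_\<tau>_line[OF _ a0_der] compose_\<tau>_line[OF _ a1_der]
  compose_\<tau>_line[OF _ c0_der] compose_\<tau>_line[OF _ der(1)] compose_\<tau>_line[OF _ der(2)] \<tau>_in_T u_nonzero_0 power_not_zero

lemma l_low_formula:
  assumes "z \<in> U"
  shows "l_low Fb z = (\<phi> (\<tau> z) / u z) *\<^sub>R Y z + \<phi>1 (\<tau> z) *\<^sub>R m z"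
proof -
  have "pd i Fb z = \<phi> (\<tau> z) / u z * Y z $ i + \<phi>1 (\<tau> z) * m z $ i" for i
  proof (rule pd_eqI_open[OF U assms])
    show "Fb z = u z * \<phi> (\<tau> z)" if "z \<in> U" for z
      using Fb[OF that] by (simp add: u_def \<tau>_def)
    show "((\<lambda>s. u (z + s *\<^sub>R axis i 1) * \<phi> (\<tau> (z + s *\<^sub>R axis i 1))) has_real_derivative
        \<phi> (\<tau> z) / u z * Y z $ i + \<phi>1 (\<tau> z) * m z $ i) (at 0)"
      by (rule DERIV_cong, (rule derivative_intros line_intros assms)+) (use u_pos[OF assms] in \<open>simp add: field_simps\<close>)
  qed
  then show ?thesis by (simp add: l_low_def vec_eq_iff)
qed

lemma pd_square_formula:
  assumes "z \<in> U"
  shows "pd j (\<lambda>z. (Fb z)\<^sup>2) z = 2 * (Y z $ j * a0 (\<tau> z) + u z * (\<phi> (\<tau> z) * \<phi>1 (\<tau> z)) * b $ j)"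
proof (rule pd_eqI_open[OF U assms])
  show "(Fb z)\<^sup>2 = (u z * \<phi> (\<tau> z))\<^sup>2" if "z \<in> U" for z
    using Fb[OF that] by (simp add: u_def \<tau>_def)
  show "((\<lambda>s. (u (z + s *\<^sub>R axis j 1) * \<phi> (\<tau> (z + s *\<^sub>R axis j 1)))\<^sup>2) has_real_derivative
      2 * (Y z $ j * a0 (\<tau> z) + u z * (\<phi> (\<tau> z) * \<phi>1 (\<tau> z)) * b $ j)) (at 0)"
    by (rule DERIV_cong, (rule derivative_intros line_intros assms)+)
       (use u_pos[OF assms] in \<open>simp add: a0_def b_component[of _ z] field_simps power2_eq_square\<close>)
qed

text \<open>Stated with \<open>b\<close>, which is constant along the fibre, rather than with \<open>m\<close>, because it is
  differentiated once more.\<close>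

lemma g_low_component:
  assumes "z \<in> U"
  shows "g_low Fb z $ i $ j = a0 (\<tau> z) * G $ i $ j + c0 (\<tau> z) * (b $ i * b $ j)
    + a1 (\<tau> z) / u z * (b $ i * Y z $ j + b $ j * Y z $ i)
    - \<tau> z * a1 (\<tau> z) / (u z)\<^sup>2 * (Y z $ i * Y z $ j)" (is "_ = ?r")
proof -
  have [simp]: "G $ j $ i = G $ i $ j"
    using sym by (metis transpose_def vec_lambda_beta)
  have "pd i (pd j (\<lambda>z. (Fb z)\<^sup>2)) z = 2 * ?r"
  proof (rule pd_eqI_open[OF U assms pd_square_formula])
    show "((\<lambda>s. 2 * (Y (z + s *\<^sub>R axis i 1) $ j * a0 (\<tau> (z + s *\<^sub>R axis i 1))
        + u (z + s *\<^sub>R axis i 1) * (\<phi> (\<tau> (z + s *\<^sub>R axis i 1)) * \<phi>1 (\<tau> (z + s *\<^sub>R axis i 1))) * b $ j))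
      has_real_derivative 2 * ?r) (at 0)"
      by (rule DERIV_cong, (rule derivative_intros line_intros assms)+)
         (use u_pos[OF assms] in \<open>simp add: a1_def c0_def b_component[of _ z] field_simps power2_eq_square\<close>)
  qed
  moreover have "g_low Fb z $ i $ j = 1/2 * pd i (pd j (\<lambda>z. (Fb z)\<^sup>2)) z"
    by (simp add: g_low_def)
  ultimately have "g_low Fb z $ i $ j = 1/2 * (2 * ?r)" by (simp only:)
  moreover have "1/2 * (2 * x) = x" for x :: real by simp
  ultimately show ?thesis by (simp only:)
qed

text \<open>In \<open>g_low - l_low \<otimes> l_low\<close> the mixed terms in \<open>m\<close> and \<open>Y\<close> cancel, since \<open>\<Psi>' = \<phi>\<phi>'\<close>, and the
  terms in \<open>Y \<otimes> Y\<close> complete \<open>a0 G\<close> to \<open>a0 h\<close>.\<close>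

lemma h_low_formula:
  assumes "z \<in> U"
  shows "h_low Fb z $ i $ j = a0 (\<tau> z) * h z i j + \<phi> (\<tau> z) * \<phi>2 (\<tau> z) * (m z $ i * m z $ j)"
  using u_pos[OF assms]
  by (simp add: h_low_def g_low_component[OF assms] l_low_formula[OF assms] h_def
      a0_def a1_def c0_def b_component[of _ z] field_simps power2_eq_square)

text \<open>Differentiating functions of \<open>\<tau>\<close> produces \<open>m\<close>, and differentiating \<open>u\<close> and \<open>Y\<close> produces \<open>Y\<close> and \<open>G\<close>. Once
  \<open>b\<close> is written in terms of \<open>m\<close> and \<open>Y\<close>, the terms free of \<open>m\<close> cancel, and the other terms in \<open>Y\<close> complete
  \<open>G\<close> to \<open>h\<close>.\<close>

lemma C_low_formula:
  assumes "z \<in> U"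
  shows "C_low Fb z i j k
    = a1 (\<tau> z) / (2 * u z) * (h z i j * m z $ k + h z k i * m z $ j + h z j k * m z $ i)
      + c1 (\<tau> z) / (2 * u z) * (m z $ i * m z $ j * m z $ k)" (is "_ = ?r")
proof -
  have [simp]: "G $ k $ i = G $ i $ k" 
    using sym by (metis transpose_def vec_lambda_beta)
  have "pd k (\<lambda>z. g_low Fb z $ i $ j) z = 2 * ?r"
  proof (rule pd_eqI_open[OF U assms g_low_component])
    show "((\<lambda>s. a0 (\<tau> (z + s *\<^sub>R axis k 1)) * G $ i $ j + c0 (\<tau> (z + s *\<^sub>R axis k 1)) * (b $ i * b $ j)
        + a1 (\<tau> (z + s *\<^sub>R axis k 1)) / u (z + s *\<^sub>R axis k 1)
          * (b $ i * Y (z + s *\<^sub>R axis k 1) $ j + b $ j * Y (z + s *\<^sub>R axis k 1) $ i)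
        - \<tau> (z + s *\<^sub>R axis k 1) * a1 (\<tau> (z + s *\<^sub>R axis k 1)) / (u (z + s *\<^sub>R axis k 1))\<^sup>2
          * (Y (z + s *\<^sub>R axis k 1) $ i * Y (z + s *\<^sub>R axis k 1) $ j))
      has_real_derivative 2 * ?r) (at 0)"
      by (rule DERIV_cong, (rule derivative_intros line_intros assms)+)
         (use u_pos[OF assms] in \<open>simp add: h_def b_component[of _ z] field_simps power2_eq_square\<close>)
  qed
  then show ?thesis by (simp add: C_low_def)
qed

end

section \<open>Inverting the changed metric on covectors that annihilate the base direction\<close>

lemma matrix_inv_inverse:
  fixes M :: "real^'n::finite^'n"
  assumes "invertible M"
  shows "M ** matrix_inv M = mat 1" and "matrix_inv M ** M = mat 1"
  using someI_ex[OF assms[unfolded invertible_def]] by (simp_all add: matrix_inv_def)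

lemma matrix_inv_symmetric:
  fixes M :: "real^'n::finite^'n"
  assumes "invertible M" and "transpose M = M"
  shows "transpose (matrix_inv M) = matrix_inv M"
proof -
  have "transpose (matrix_inv M) ** M = mat 1"
    using arg_cong[OF matrix_inv_inverse(1)[OF assms(1)], of transpose] assms(2)
    by (simp add: matrix_transpose_mul)
  then have "transpose (matrix_inv M) ** (M ** matrix_inv M) = matrix_inv M"
    by (simp add: matrix_mul_assoc)
  then show ?thesis by (simp add: matrix_inv_inverse(1)[OF assms(1)])
qed

lemma inner_symmetric_matrix:
  fixes M :: "real^'n::finite^'n"
  assumes "transpose M = M"
  shows "x \<bullet> (M *v z) = (M *v x) \<bullet> z"
  using dot_lmul_matrix[of x M z] vector_transpose_matrix[of x M] assms by simp

lemma double_sum_eq_inner: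
  fixes W :: "real^'n::finite^'n"
  shows "(\<Sum>j\<in>UNIV. \<Sum>k\<in>UNIV. W $ j $ k * x $ j * z $ k) = x \<bullet> (W *v z)"
  by (simp add: inner_vec_def matrix_vector_mult_def sum_distrib_left algebra_simps)

text \<open>The metric \<open>M\<close> is a rank two perturbation of \<open>a H\<close>, where \<open>H\<close> is the angular metric of \<open>G\<close> in the
  direction \<open>y\<close>. The inverse of \<open>G\<close> enters only through the vector \<open>\<zeta>\<close> that represents \<open>m\<close>;
  \<open>m \<bullet> \<zeta>\<close> is \<open>m\<^sup>2\<close>.\<close>

locale angular_decomposition =
  fixes G M H :: "real^'n::finite^'n" and y m l \<zeta> :: "real^'n" and a q :: real
  assumes G_sym: "transpose G = G"
    and G_nz: "y \<bullet> (G *v y) \<noteq> 0"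
    and H: "H $ i $ j = G $ i $ j - (G *v y) $ i * (G *v y) $ j / (y \<bullet> (G *v y))"
    and M: "M $ i $ j = a * H $ i $ j + q * (m $ i * m $ j) + l $ i * l $ j"
    and \<zeta>: "G *v \<zeta> = m"
    and my: "m \<bullet> y = 0" and ly: "l \<bullet> y \<noteq> 0"
    and inv: "invertible M"
    and a: "a \<noteq> 0" and N: "a + q * (m \<bullet> \<zeta>) \<noteq> 0"
begin

definition W :: "real^'n^'n" where "W = matrix_inv M"
definition w :: "real^'n" where "w = W *v m"

lemma H_sym_component: "H $ i $ j = H $ j $ i"
proof -
  have "transpose G $ i $ j = G $ j $ i" by (simp add: transpose_def)
  then show ?thesis using G_sym by (simp add: H mult.commute)
qed

lemma M_sym: "transpose M = M"
  by (simp add: transpose_def vec_eq_iff M H_sym_component mult.commute)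

lemma W_sym: "transpose W = W"
  unfolding W_def by (rule matrix_inv_symmetric[OF inv M_sym])

lemma M_W: "M *v (W *v x) = x" and W_M: "W *v (M *v x) = x"
  using matrix_inv_inverse[OF inv] by (simp_all add: W_def matrix_vector_mul_assoc)

lemma H_mult: "H *v x = G *v x - ((G *v y) \<bullet> x / (y \<bullet> (G *v y))) *\<^sub>R (G *v y)"
proof -
  have "(H *v x) $ i = (G *v x) $ i - (G *v y) $ i / (y \<bullet> (G *v y)) * (\<Sum>j\<in>UNIV. (G *v y) $ j * x $ j)" for i
    unfolding matrix_vector_mult_def[of H] matrix_vector_mult_def[of G x]
    by (simp add: H left_diff_distrib sum_subtractf sum_distrib_left mult.assoc)
  then show ?thesis by (simp add: vec_eq_iff inner_vec_def[of "G *v y" x])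
qed

lemma M_mult: "M *v x = a *\<^sub>R (H *v x) + (q * (m \<bullet> x)) *\<^sub>R m + (l \<bullet> x) *\<^sub>R l"
proof -
  have "(M *v x) $ i = a * (\<Sum>j\<in>UNIV. H $ i $ j * x $ j) + q * (\<Sum>j\<in>UNIV. m $ j * x $ j) * m $ i
      + (\<Sum>j\<in>UNIV. l $ j * x $ j) * l $ i" for i
    by (simp add: matrix_vector_mult_def M distrib_left distrib_right sum.distrib sum_distrib_left mult_ac)
  then show ?thesis by (simp add: vec_eq_iff inner_vec_def matrix_vector_mult_def)
qed

lemma y_H: "y \<bullet> (H *v x) = 0"
  using G_nz inner_symmetric_matrix[OF G_sym, of y x] by (simp add: H_mult inner_diff_right)

lemma \<zeta>_H: "\<zeta> \<bullet> (H *v x) = m \<bullet> x"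
  using inner_symmetric_matrix[OF G_sym, of \<zeta>] \<zeta> my by (simp add: H_mult inner_diff_right)

text \<open>Pair \<open>M w = m\<close> with \<open>y\<close>: only the term with \<open>l\<close> survives on the left, and \<open>m \<bullet> y = 0\<close> on the right.\<close>

lemma l_w: "l \<bullet> w = 0"
proof -
  have "y \<bullet> (M *v w) = 0" using my by (simp add: w_def M_W inner_commute)
  then show ?thesis
    using my ly by (simp add: M_mult inner_add_right y_H inner_commute)
qed

text \<open>Pair \<open>M w = m\<close> with \<open>\<zeta>\<close>, on which \<open>H\<close> acts like \<open>G\<close>.\<close>

lemma m_w: "m \<bullet> w = (m \<bullet> \<zeta>) / (a + q * (m \<bullet> \<zeta>))"
proof -
  have "\<zeta> \<bullet> (M *v w) = m \<bullet> \<zeta>" by (simp add: w_def M_W inner_commute)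
  then have "(m \<bullet> w) * (a + q * (m \<bullet> \<zeta>)) = m \<bullet> \<zeta>"
    by (simp add: M_mult inner_add_right \<zeta>_H l_w inner_commute algebra_simps)
  then show ?thesis using N by (simp add: field_simps)
qed

lemma H_w: "H *v w = (1 / (a + q * (m \<bullet> \<zeta>))) *\<^sub>R m"
proof -
  have "a *\<^sub>R (H *v w) + (q * (m \<bullet> w)) *\<^sub>R m = m"
    using M_mult[of w] by (simp add: w_def[symmetric] l_w) (simp add: w_def M_W)
  then have "a *\<^sub>R (H *v w) = (1 - q * (m \<bullet> w)) *\<^sub>R m"
    by (simp add: algebra_simps)
  also have "1 - q * (m \<bullet> w) = a * (1 / (a + q * (m \<bullet> \<zeta>)))"
    unfolding m_w using N by (simp add: field_simps)
  finally have "a *\<^sub>R (H *v w) = a *\<^sub>R ((1 / (a + q * (m \<bullet> \<zeta>))) *\<^sub>R m)" by simp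
  then show ?thesis using a by (simp only: scaleR_cancel_left) simp
qed

text \<open>Contract \<open>M = a H + q m \<otimes> m + l \<otimes> l\<close> with \<open>W\<close>. The left side gives the dimension, and \<open>l \<otimes> l\<close>
  gives one, because \<open>M y\<close> is a multiple of \<open>l\<close>.\<close>

lemma trace_W_H:
  "(\<Sum>j\<in>UNIV. \<Sum>k\<in>UNIV. H $ j $ k * W $ j $ k) = (real CARD('n) - 1 - q * (m \<bullet> w)) / a"
proof -
  have "M *v y = (l \<bullet> y) *\<^sub>R l"
    using my by (simp add: M_mult) (simp add: H_mult G_nz inner_commute)
  then have "y = (l \<bullet> y) *\<^sub>R (W *v l)"
    using W_M[of y] by (simp add: matrix_vector_mult_scaleR)
  then have "l \<bullet> y = (l \<bullet> y) * (l \<bullet> (W *v l))"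
    by (metis inner_scaleR_right)
  then have ll: "l \<bullet> (W *v l) = 1" using ly by simp
  have "(\<Sum>j\<in>UNIV. \<Sum>k\<in>UNIV. M $ j $ k * W $ j $ k) = trace (M ** W)"
    using W_sym by (simp add: trace_def matrix_matrix_mult_def transpose_def vec_eq_iff)
  also have "\<dots> = real CARD('n)"
    using matrix_inv_inverse(1)[OF inv] by (simp add: W_def trace_I)
  finally have tr: "(\<Sum>j\<in>UNIV. \<Sum>k\<in>UNIV. M $ j $ k * W $ j $ k) = real CARD('n)" .
  have "(\<Sum>j\<in>UNIV. \<Sum>k\<in>UNIV. M $ j $ k * W $ j $ k)
      = a * (\<Sum>j\<in>UNIV. \<Sum>k\<in>UNIV. H $ j $ k * W $ j $ k)
        + q * (\<Sum>j\<in>UNIV. \<Sum>k\<in>UNIV. W $ j $ k * m $ j * m $ k)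
        + (\<Sum>j\<in>UNIV. \<Sum>k\<in>UNIV. W $ j $ k * l $ j * l $ k)"
    by (simp add: M sum.distrib sum_distrib_left distrib_left distrib_right mult_ac)
  then show ?thesis
    unfolding tr double_sum_eq_inner ll w_def[symmetric] using a
    by (simp add: nonzero_eq_divide_eq mult.commute)
qed

text \<open>With the coefficients of the Cartan tensor for \<open>\<alpha>\<close> and \<open>\<gamma>\<close>, the left side is the mean Cartan tensor. It is
  proportional to \<open>m\<close> because \<open>H\<close> maps \<open>w\<close> to a multiple of \<open>m\<close>.\<close>

lemma contraction:
  "(\<Sum>j\<in>UNIV. \<Sum>k\<in>UNIV. (\<alpha> * (H $ i $ j * m $ k + H $ k $ i * m $ j + H $ j $ k * m $ i)
      + \<gamma> * (m $ i * m $ j * m $ k)) * W $ j $ k)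
   = (\<alpha> * ((real CARD('n) + 1) / a - 3 * q * (m \<bullet> w) / a) + \<gamma> * (m \<bullet> w)) * m $ i"
proof -
  have 1: "(\<Sum>j\<in>UNIV. \<Sum>k\<in>UNIV. H $ i $ j * m $ k * W $ j $ k) = (H *v w) $ i"
    by (simp add: w_def matrix_vector_mult_def sum_distrib_left algebra_simps)
  have "transpose W $ k $ j = W $ j $ k" for j k by (simp add: transpose_def)
  then have Wc: "W $ j $ k = W $ k $ j" for j k using W_sym by simp
  have 2: "(\<Sum>j\<in>UNIV. \<Sum>k\<in>UNIV. H $ k $ i * m $ j * W $ j $ k) = (H *v w) $ i"
    unfolding 1[symmetric] by (subst sum.swap) (simp add: H_sym_component[of _ i] Wc)
  have 3: "(\<Sum>j\<in>UNIV. \<Sum>k\<in>UNIV. m $ j * m $ k * W $ j $ k) = m \<bullet> w"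
    unfolding w_def double_sum_eq_inner[symmetric] by (simp add: algebra_simps)
  have "(\<Sum>j\<in>UNIV. \<Sum>k\<in>UNIV. (\<alpha> * (H $ i $ j * m $ k + H $ k $ i * m $ j + H $ j $ k * m $ i)
      + \<gamma> * (m $ i * m $ j * m $ k)) * W $ j $ k)
    = \<alpha> * (\<Sum>j\<in>UNIV. \<Sum>k\<in>UNIV. H $ i $ j * m $ k * W $ j $ k)
      + \<alpha> * (\<Sum>j\<in>UNIV. \<Sum>k\<in>UNIV. H $ k $ i * m $ j * W $ j $ k)
      + \<alpha> * m $ i * (\<Sum>j\<in>UNIV. \<Sum>k\<in>UNIV. H $ j $ k * W $ j $ k)
      + \<gamma> * m $ i * (\<Sum>j\<in>UNIV. \<Sum>k\<in>UNIV. m $ j * m $ k * W $ j $ k)"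
    by (simp add: sum_distrib_left sum.distrib algebra_simps)
  also have "\<dots> = (\<alpha> * (2 / (a + q * (m \<bullet> \<zeta>)) + (real CARD('n) - 1 - q * (m \<bullet> w)) / a)
      + \<gamma> * (m \<bullet> w)) * m $ i"
    unfolding 1 2 3 trace_W_H H_w by (simp add: algebra_simps)
  also have "2 / (a + q * (m \<bullet> \<zeta>)) = (2 - 2 * q * (m \<bullet> w)) / a"
    unfolding m_w using a N by (simp add: divide_simps)
  also have "(2 - 2 * q * (m \<bullet> w)) / a + (real CARD('n) - 1 - q * (m \<bullet> w)) / a
      = (real CARD('n) + 1) / a - 3 * q * (m \<bullet> w) / a"
    by (simp add: add_divide_distrib[symmetric] diff_divide_distrib[symmetric])
  finally show ?thesis .
qed

end

section \<open>Semi-C-reducibility in one fibre\<close>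

context beta_change_of_quadratic
begin

text \<open>The number \<open>\<lambda>\<close> of the theorem, written with the metric \<open>G\<close>; \<open>\<mu>\<close> stands for \<open>m\<^sup>2\<close> with respect to
  \<open>G\<close>, which is \<open>e\<^sup>-\<^sup>2\<^sup>\<sigma>\<close> times the one for \<open>g\<close>.\<close>

definition mean_coef :: "real^'n \<Rightarrow> real \<Rightarrow> real" where
  "mean_coef z \<mu> = (real CARD('n) + 1) * a1 (\<tau> z) / (2 * u z * a0 (\<tau> z))
     - 3 * a1 (\<tau> z) * (\<phi> (\<tau> z) * \<phi>2 (\<tau> z)) * \<mu>
         / (2 * u z * a0 (\<tau> z) * (a0 (\<tau> z) + \<phi> (\<tau> z) * \<phi>2 (\<tau> z) * \<mu>))
     + c1 (\<tau> z) * \<mu> / (2 * u z * (a0 (\<tau> z) + \<phi> (\<tau> z) * \<phi>2 (\<tau> z) * \<mu>))"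

lemma m_inner_z:
  assumes "z \<in> U"
  shows "m z \<bullet> z = 0"
proof -
  have "Y z \<bullet> z = (u z)\<^sup>2"
    using pos[OF assms] by (simp add: u_def Y_def inner_commute)
  then show ?thesis
    using u_pos[OF assms] by (simp add: m_def \<tau>_def inner_diff_left power2_eq_square)
qed

text \<open>The mean Cartan tensor is \<open>mean_coef z \<mu>\<close> times \<open>m\<close>. Eliminating \<open>m\<close> and \<open>h\<close> from the Cartan tensor
  in its favour leaves a multiple of the symmetric product of the new angular metric with it, which
  fixes \<open>r\<close>, and a multiple of its cube. That the latter coefficient belongs to \<open>1 - r\<close> amounts to
  the formula that defines \<open>mean_coef\<close>.\<close>

lemma semi_C_reducible_fibre:
  fixes \<zeta> :: "real^'n"
  assumes z: "z \<in> U" and inv: "invertible (g_low Fb z)" and Fb_nz: "Fb z \<noteq> 0"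
    and \<zeta>: "G *v \<zeta> = m z" and a: "a0 (\<tau> z) \<noteq> 0"
    and \<mu>: "\<mu> = m z \<bullet> \<zeta>" "\<mu> \<noteq> 0"
    and NZ: "a0 (\<tau> z) + \<phi> (\<tau> z) * \<phi>2 (\<tau> z) * \<mu> \<noteq> 0"
    and lam: "mean_coef z \<mu> \<noteq> 0"
    and r: "r = (real CARD('n) + 1) * a1 (\<tau> z) / (2 * u z * a0 (\<tau> z) * mean_coef z \<mu>)"
  shows "C_sq Fb z \<noteq> 0"
    and "C_low Fb z i j k = r / (real CARD('n) + 1)
        * (h_low Fb z $ i $ j * C_vec Fb z $ k + h_low Fb z $ k $ i * C_vec Fb z $ j
           + h_low Fb z $ j $ k * C_vec Fb z $ i)
      + (1 - r) / C_sq Fb z * C_vec Fb z $ i * C_vec Fb z $ j * C_vec Fb z $ k"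
proof -
  let ?a = "a0 (\<tau> z)" and ?q = "\<phi> (\<tau> z) * \<phi>2 (\<tau> z)" and ?l = "l_low Fb z"
  let ?lam = "mean_coef z \<mu>" and ?\<alpha> = "a1 (\<tau> z) / (2 * u z)" and ?\<gamma> = "c1 (\<tau> z) / (2 * u z)"
  let ?H = "\<chi> i j. h z i j"
  have u0: "0 < u z" by (rule u_pos[OF z])
  have Q: "(u z)\<^sup>2 = z \<bullet> (G *v z)" using pos[OF z] by (simp add: u_def)
  have \<phi>0: "\<phi> (\<tau> z) \<noteq> 0" using Fb_nz Fb[OF z] by (simp add: u_def \<tau>_def)
  have "Y z \<bullet> z = (u z)\<^sup>2" by (simp add: Q Y_def inner_commute)
  then have ly: "?l \<bullet> z = \<phi> (\<tau> z) * u z"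
    using u0 by (simp add: l_low_formula[OF z] inner_add_left m_inner_z[OF z] power2_eq_square)
  interpret angular_decomposition G "g_low Fb z" ?H z "m z" ?l \<zeta> ?a ?q
  proof
    show "z \<bullet> (G *v z) \<noteq> 0" using pos[OF z] by simp
    show "?H $ i $ j = G $ i $ j - (G *v z) $ i * (G *v z) $ j / (z \<bullet> (G *v z))" for i j
      by (simp add: h_def Q Y_def)
    show "g_low Fb z $ i $ j = ?a * ?H $ i $ j + ?q * (m z $ i * m z $ j) + ?l $ i * ?l $ j" for i j
      using h_low_formula[OF z, of i j] by (simp add: h_low_def)
    show "?l \<bullet> z \<noteq> 0" using ly \<phi>0 u0 by simp
    show "?a + ?q * (m z \<bullet> \<zeta>) \<noteq> 0" using NZ \<mu>(1) by simp
  qed (use sym \<zeta> m_inner_z[OF z] inv a in auto)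
  let ?N = "?a + ?q * \<mu>"
  have mw: "m z \<bullet> w = \<mu> / ?N" using m_w \<mu>(1) by simp
  have "C_vec Fb z $ i = ?lam * m z $ i" for i
  proof -
    have "C_vec Fb z $ i = (?\<alpha> * ((real CARD('n) + 1) / ?a - 3 * ?q * (\<mu> / ?N) / ?a) + ?\<gamma> * (\<mu> / ?N)) * m z $ i"
      using contraction[where i = i and \<alpha> = ?\<alpha> and \<gamma> = ?\<gamma>]
      by (simp add: C_vec_def g_up_def W_def[symmetric] C_low_formula[OF z] mw)
    also have "?\<alpha> * ((real CARD('n) + 1) / ?a - 3 * ?q * (\<mu> / ?N) / ?a) + ?\<gamma> * (\<mu> / ?N) = ?lam"
      by (simp add: mean_coef_def right_diff_distrib mult_ac)
    finally show ?thesis .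
  qed
  then have C: "C_vec Fb z = ?lam *\<^sub>R m z" by (simp add: vec_eq_iff)
  have "C_sq Fb z = C_vec Fb z \<bullet> (W *v C_vec Fb z)"
    unfolding C_sq_def sq_norm_def g_up_def W_def[symmetric] by (rule double_sum_eq_inner)
  also have "\<dots> = ?lam\<^sup>2 * (\<mu> / ?N)"
    by (simp add: C matrix_vector_mult_scaleR w_def[symmetric] mw power2_eq_square)
  finally have Csq: "C_sq Fb z = ?lam\<^sup>2 * (\<mu> / ?N)" .
  show "C_sq Fb z \<noteq> 0" using lam \<mu>(2) NZ by (simp add: Csq)
  define s where "s = ?\<alpha> / (?a * ?lam)"
  have s: "s * ?lam = ?\<alpha> / ?a"
    using lam by (simp add: s_def)
  have "r = (real CARD('n) + 1) * s" by (simp add: r s_def)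
  then have s_r: "r / (real CARD('n) + 1) = s"
    by (simp add: nonzero_divide_eq_eq add_nonneg_eq_0_iff)
  have "(1 - r) * ?lam * ?N = (?\<gamma> - 3 * ?\<alpha> * ?q / ?a) * \<mu>"
  proof -
    have "r * ?lam = (real CARD('n) + 1) * a1 (\<tau> z) / (2 * u z * ?a)"
      using lam u0 a by (simp add: r field_simps)
    then have "(1 - r) * ?lam = - (3 * a1 (\<tau> z) * ?q * \<mu> / (2 * u z * ?a * ?N)) + c1 (\<tau> z) * \<mu> / (2 * u z * ?N)"
      unfolding left_diff_distrib by (simp add: mean_coef_def)
    also have "\<dots> = ((?\<gamma> - 3 * ?\<alpha> * ?q / ?a) * \<mu>) / ?N"
      by (simp add: left_diff_distrib diff_divide_distrib)
    finally show ?thesis using NZ by simp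
  qed
  moreover have cancel: "x / (L\<^sup>2 * (\<nu> / N)) * L ^ 3 = K"
    if "x * L * N = K * \<nu>" "L \<noteq> 0" "\<nu> \<noteq> 0" "N \<noteq> 0" for x L N K \<nu> :: real
    using that by (simp add: field_simps power2_eq_square power3_eq_cube)
  ultimately have t: "(1 - r) / C_sq Fb z * ?lam ^ 3 = ?\<gamma> - 3 * ?\<alpha> * ?q / ?a"
    unfolding Csq using lam \<mu>(2) NZ by (intro cancel)
  let ?T = "m z $ i * m z $ j * m z $ k"
  have "C_low Fb z i j k = ?\<alpha> / ?a * (h_low Fb z $ i $ j * m z $ k + h_low Fb z $ k $ i * m z $ j
      + h_low Fb z $ j $ k * m z $ i) + (?\<gamma> - 3 * ?\<alpha> * ?q / ?a) * ?T"
    using a u0 by (simp add: C_low_formula[OF z] h_low_formula[OF z] field_simps)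
  also have "\<dots> = s * (h_low Fb z $ i $ j * (?lam * m z $ k) + h_low Fb z $ k $ i * (?lam * m z $ j)
      + h_low Fb z $ j $ k * (?lam * m z $ i))
      + (1 - r) / C_sq Fb z * (?lam * m z $ i) * (?lam * m z $ j) * (?lam * m z $ k)"
    unfolding s[symmetric] t[symmetric] by (simp add: algebra_simps power3_eq_cube)
  finally show "C_low Fb z i j k = r / (real CARD('n) + 1)
        * (h_low Fb z $ i $ j * C_vec Fb z $ k + h_low Fb z $ k $ i * C_vec Fb z $ j
           + h_low Fb z $ j $ k * C_vec Fb z $ i)
      + (1 - r) / C_sq Fb z * C_vec Fb z $ i * C_vec Fb z $ j * C_vec Fb z $ k"
    by (simp add: C s_r)
qed

end

section \<open>Reducing a homogeneous function of two variables to one variable\<close>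

lemma smooth_on_D2:
  fixes f :: "real \<Rightarrow> real \<Rightarrow> real"
  assumes "open \<Omega>" and f: "smooth_on \<Omega> (\<lambda>(u, b). f u b)"
  shows "smooth_on \<Omega> (\<lambda>(u, b). D2 f u b)"
    and "(u, b) \<in> \<Omega> \<Longrightarrow> (f u has_real_derivative D2 f u b) (at b)"
proof -
  let ?D = "\<lambda>x. frechet_derivative (\<lambda>(u, b). f u b) (at x) (0, 1)"
  have d: "(f u has_real_derivative ?D (u, b)) (at b)" if "(u, b) \<in> \<Omega>" for u b
  proof -
    have F: "((\<lambda>(u, b). f u b) has_derivative frechet_derivative (\<lambda>(u, b). f u b) (at (u, b))) (at (u, b))"
      by (rule smooth_on_has_derivative[OF f that])
    have "((\<lambda>b. (u, b)) has_derivative (\<lambda>b. (0, b))) (at b)"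
      by (rule has_derivative_Pair[OF has_derivative_const has_derivative_ident])
    from has_derivative_compose[OF this F]
    have "(f u has_derivative (\<lambda>x. frechet_derivative (\<lambda>(u, b). f u b) (at (u, b)) (0, x))) (at b)"
      by (simp only: case_prod_conv)
    moreover have "frechet_derivative (\<lambda>(u, b). f u b) (at (u, b)) (0, x) = ?D (u, b) * x" for x
      using linear_cmul[OF has_derivative_linear[OF F], of x "(0, 1)"] by (simp add: mult.commute)
    then have "(\<lambda>x. frechet_derivative (\<lambda>(u, b). f u b) (at (u, b)) (0, x)) = (*) (?D (u, b))"
      by (rule ext)
    ultimately show ?thesis by (simp only: has_field_derivative_def)
  qed
  have D: "D2 f u b = ?D (u, b)" if "(u, b) \<in> \<Omega>" for u b
    unfolding D2_def by (rule DERIV_imp_deriv) (rule d[OF that])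
  show "smooth_on \<Omega> (\<lambda>(u, b). D2 f u b)"
  proof (rule smooth_on_cong[THEN iffD2, OF \<open>open \<Omega>\<close> _ smooth_on_frechet_derivative[OF f]])
    show "(case x of (u, b) \<Rightarrow> D2 f u b) = ?D x" if "x \<in> \<Omega>" for x
      using D[of "fst x" "snd x"] that by (simp only: prod.collapse case_prod_unfold)
  qed
  show "(f u has_real_derivative D2 f u b) (at b)" if "(u, b) \<in> \<Omega>"
    using d[OF that] by (simp only: D[OF that])
qed

text \<open>Because of \<open>f(u, b) = u f(1, b/u)\<close>, all partial derivatives of \<open>f\<close> that occur in the coefficients of
  the change are expressed by derivatives of \<open>f(1, -)\<close>. This makes the symmetry of second partial
  derivatives and the homogeneity relations between them automatic.\<close>

locale homogeneous_function =
  fixes \<Omega> :: "(real \<times> real) set" and f :: "real \<Rightarrow> real \<Rightarrow> real"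
  assumes smooth_homogeneous: "smooth_homogeneous \<Omega> f"
begin

definition T :: "real set" where "T = {\<tau>. (1, \<tau>) \<in> \<Omega>}"

lemma open_\<Omega>: "open \<Omega>"
  using smooth_homogeneous unfolding smooth_homogeneous_def by (elim conjE)

lemma smooth: "smooth_on \<Omega> (\<lambda>(u, b). f u b)"
  using smooth_homogeneous unfolding smooth_homogeneous_def by (elim conjE)

lemma
  assumes "(u, b) \<in> \<Omega>" and "0 < k"
  shows cone: "(k * u, k * b) \<in> \<Omega>" and hom: "f (k * u) (k * b) = k * f u b"
proof -
  have "\<forall>(s, b)\<in>\<Omega>. \<forall>k>0. (k * s, k * b) \<in> \<Omega> \<and> f (k * s) (k * b) = k * f s b"
    using smooth_homogeneous unfolding smooth_homogeneous_def by (elim conjE)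
  from bspec[OF this assms(1), unfolded case_prod_conv, rule_format, OF assms(2)]
  show "(k * u, k * b) \<in> \<Omega>" and "f (k * u) (k * b) = k * f u b" by (rule conjunct1, rule conjunct2)
qed

lemma slope_in_T:
  assumes "(u, b) \<in> \<Omega>" and "0 < u"
  shows "b / u \<in> T"
proof -
  have "0 < 1 / u" using assms(2) by simp
  from cone[OF assms(1) this] show ?thesis using assms(2) by (simp add: T_def)
qed

lemma T_der:
  assumes "\<tau> \<in> T"
  shows "(f 1 has_real_derivative D2 f 1 \<tau>) (at \<tau>)"
    and "(D2 f 1 has_real_derivative D2 (D2 f) 1 \<tau>) (at \<tau>)"
    and "(D2 (D2 f) 1 has_real_derivative D2 (D2 (D2 f)) 1 \<tau>) (at \<tau>)"
proof -
  have \<tau>: "(1, \<tau>) \<in> \<Omega>" using assms by (simp add: T_def)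
  note s1 = smooth_on_D2(1)[OF open_\<Omega> smooth]
  note s2 = smooth_on_D2(1)[OF open_\<Omega> s1]
  show "(f 1 has_real_derivative D2 f 1 \<tau>) (at \<tau>)"
    by (rule smooth_on_D2(2)[OF open_\<Omega> smooth \<tau>])
  show "(D2 f 1 has_real_derivative D2 (D2 f) 1 \<tau>) (at \<tau>)"
    by (rule smooth_on_D2(2)[OF open_\<Omega> s1 \<tau>])
  show "(D2 (D2 f) 1 has_real_derivative D2 (D2 (D2 f)) 1 \<tau>) (at \<tau>)"
    by (rule smooth_on_D2(2)[OF open_\<Omega> s2 \<tau>])
qed

lemma f_eq:
  assumes "(u, b) \<in> \<Omega>" and "0 < u"
  shows "f u b = u * f 1 (b / u)"
proof -
  have "(1, b / u) \<in> \<Omega>" using slope_in_T[OF assms] by (simp add: T_def)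
  from hom[OF this assms(2)] show ?thesis using assms(2) by simp
qed

lemma D2_eqI:
  assumes "(u, b) \<in> \<Omega>" and "0 < u"
    and eq: "\<And>b. (u, b) \<in> \<Omega> \<Longrightarrow> g u b = \<psi> b"
    and "(\<psi> has_real_derivative d) (at b)"
  shows "D2 g u b = d"
proof -
  have "open ((\<lambda>b. (u, b)) -` \<Omega>)"
    by (intro open_vimage open_\<Omega> continuous_intros)
  then have "\<forall>\<^sub>F b in nhds b. (u, b) \<in> \<Omega>"
    using assms(1) by (auto simp: eventually_nhds intro!: exI[of _ "(\<lambda>b. (u, b)) -` \<Omega>"])
  then have "\<forall>\<^sub>F b in nhds b. g u b = \<psi> b"
    by (rule eventually_mono) (rule eq)
  then have "deriv (g u) b = deriv \<psi> b"
    by (rule deriv_cong_ev) (rule refl)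
  then show ?thesis
    using assms(4) by (simp add: D2_def DERIV_imp_deriv)
qed

lemma quotient_der:
  assumes "(\<psi> has_real_derivative d) (at (b / u))"
  shows "((\<lambda>b. \<psi> (b / u)) has_real_derivative d / u) (at b)"
  by (rule DERIV_cong[OF DERIV_chain2[OF assms DERIV_cdivide[OF DERIV_ident]]]) simp

lemma D2_eq:
  assumes "(u, b) \<in> \<Omega>" and "0 < u"
  shows "D2 f u b = D2 f 1 (b / u)"
proof (rule D2_eqI[OF assms])
  show "f u b = u * f 1 (b / u)" if "(u, b) \<in> \<Omega>" for b by (rule f_eq[OF that assms(2)])
  show "((\<lambda>b. u * f 1 (b / u)) has_real_derivative D2 f 1 (b / u)) (at b)"
    using DERIV_cmult[OF quotient_der[OF T_der(1)[OF slope_in_T[OF assms]]], of u] assms(2) by simp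
qed

lemma D22_eq:
  assumes "(u, b) \<in> \<Omega>" and "0 < u"
  shows "D2 (D2 f) u b = D2 (D2 f) 1 (b / u) / u"
proof (rule D2_eqI[OF assms])
  show "D2 f u b = D2 f 1 (b / u)" if "(u, b) \<in> \<Omega>" for b by (rule D2_eq[OF that assms(2)])
  show "((\<lambda>b. D2 f 1 (b / u)) has_real_derivative D2 (D2 f) 1 (b / u) / u) (at b)"
    by (rule quotient_der[OF T_der(2)[OF slope_in_T[OF assms]]])
qed

lemma D1_eq:
  assumes "(u, b) \<in> \<Omega>" and "0 < u"
  shows "D1 f u b = f 1 (b / u) - b / u * D2 f 1 (b / u)"
proof -
  have "open ((\<lambda>u. (u, b)) -` \<Omega> \<inter> {0<..})"
    by (intro open_Int open_vimage open_\<Omega> continuous_intros)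
  then have "\<forall>\<^sub>F x in nhds u. (x, b) \<in> \<Omega> \<and> 0 < x"
    using assms by (auto simp: eventually_nhds intro!: exI[of _ "(\<lambda>u. (u, b)) -` \<Omega> \<inter> {0<..}"])
  then have "\<forall>\<^sub>F x in nhds u. f x b = x * f 1 (b / x)"
    by (rule eventually_mono) (elim conjE, rule f_eq)
  then have "deriv (\<lambda>x. f x b) u = deriv (\<lambda>x. x * f 1 (b / x)) u"
    by (rule deriv_cong_ev) (rule refl)
  also have "((\<lambda>x. x * f 1 (b / x)) has_real_derivative
      1 * f 1 (b / u) + (D2 f 1 (b / u) * (- (b / u\<^sup>2))) * u) (at u)"
  proof (rule DERIV_mult[OF DERIV_ident DERIV_chain2[OF T_der(1)]])
    show "b / u \<in> T" using slope_in_T assms by simp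
    show "((/) b has_real_derivative - (b / u\<^sup>2)) (at u)"
      by (rule DERIV_cong[OF DERIV_divide[OF DERIV_const DERIV_ident]])
         (use assms(2) in \<open>simp_all add: power2_eq_square\<close>)
  qed
  then have "deriv (\<lambda>x. x * f 1 (b / x)) u = 1 * f 1 (b / u) + (D2 f 1 (b / u) * (- (b / u\<^sup>2))) * u"
    by (rule DERIV_imp_deriv)
  finally show ?thesis using assms(2) by (simp add: D1_def power2_eq_square field_simps)
qed

lemma D2_D1_eq:
  assumes "(u, b) \<in> \<Omega>" and "0 < u"
  shows "D2 (D1 f) u b = - (b / u * D2 (D2 f) 1 (b / u) / u)"
proof (rule D2_eqI[OF assms])
  show "D1 f u b = f 1 (b / u) - b / u * D2 f 1 (b / u)" if "(u, b) \<in> \<Omega>" for b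
    by (rule D1_eq[OF that assms(2)])
  note T = slope_in_T[OF assms]
  have "((\<lambda>x. f 1 x - x * D2 f 1 x) has_real_derivative - (b / u * D2 (D2 f) 1 (b / u))) (at (b / u))"
    by (rule DERIV_cong, (rule derivative_intros T_der[OF T])+) (simp add: field_simps)
  from quotient_der[OF this]
  show "((\<lambda>b. f 1 (b / u) - b / u * D2 f 1 (b / u)) has_real_derivative
      - (b / u * D2 (D2 f) 1 (b / u) / u)) (at b)" by simp
qed

lemma D2_p0_eq:
  assumes "(u, b) \<in> \<Omega>" and "0 < u"
  shows "D2 (p0_fun f) u b
    = (3 * D2 f 1 (b / u) * D2 (D2 f) 1 (b / u) + f 1 (b / u) * D2 (D2 (D2 f)) 1 (b / u)) / u"
proof (rule D2_eqI[OF assms])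
  note T = slope_in_T[OF assms]
  show "p0_fun f u b = (D2 f 1 (b / u))\<^sup>2 + f 1 (b / u) * D2 (D2 f) 1 (b / u)" if "(u, b) \<in> \<Omega>" for b
    unfolding p0_fun_def f_eq[OF that assms(2)] D2_eq[OF that assms(2)] D22_eq[OF that assms(2)]
    using assms(2) by simp
  have "((\<lambda>x. (D2 f 1 x)\<^sup>2 + f 1 x * D2 (D2 f) 1 x) has_real_derivative
      3 * D2 f 1 (b / u) * D2 (D2 f) 1 (b / u) + f 1 (b / u) * D2 (D2 (D2 f)) 1 (b / u)) (at (b / u))"
    by (rule DERIV_cong, (rule derivative_intros T_der[OF T])+) (simp add: algebra_simps)
  from quotient_der[OF this]
  show "((\<lambda>b. (D2 f 1 (b / u))\<^sup>2 + f 1 (b / u) * D2 (D2 f) 1 (b / u)) has_real_derivative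
      (3 * D2 f 1 (b / u) * D2 (D2 f) 1 (b / u) + f 1 (b / u) * D2 (D2 (D2 f)) 1 (b / u)) / u) (at b)" .
qed

end

section \<open>Pulling back quadratic forms\<close>

lemma open_contains_segment:
  fixes U :: "'a::real_normed_vector set"
  assumes "open U" and "z \<in> U"
  obtains \<epsilon> where "0 < \<epsilon>" "z + \<epsilon> *\<^sub>R v \<in> U" "z - \<epsilon> *\<^sub>R v \<in> U"
proof -
  obtain e where e: "0 < e" "ball z e \<subseteq> U" using assms by (auto elim: openE)
  define w where "w = norm v + 1"
  have w: "0 < w" using norm_ge_zero[of v] by (simp add: w_def add_nonneg_pos)
  define \<epsilon> where "\<epsilon> = e / 2 / w"
  have "0 < \<epsilon>" using e(1) w by (simp add: \<epsilon>_def)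
  moreover have "\<epsilon> * norm v < e"
  proof -
    have "\<epsilon> * norm v \<le> \<epsilon> * w" using \<open>0 < \<epsilon>\<close> by (simp add: w_def)
    also have "\<dots> = e / 2" using w by (simp add: \<epsilon>_def)
    finally show ?thesis using e(1) by simp
  qed
  then have "z + \<epsilon> *\<^sub>R v \<in> ball z e" "z - \<epsilon> *\<^sub>R v \<in> ball z e"
    using \<open>0 < \<epsilon>\<close> by (simp_all add: dist_norm)
  ultimately show thesis using e(2) that by blast
qed

lemma linear_eq_on_open:
  fixes d :: "'a::real_normed_vector \<Rightarrow> 'b::real_vector"
  assumes "open U" and "z \<in> U" and "linear d" and "\<And>z. z \<in> U \<Longrightarrow> d z = 0"
  shows "d v = 0"
proof -
  obtain \<epsilon> where "0 < \<epsilon>" "z + \<epsilon> *\<^sub>R v \<in> U"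
    using open_contains_segment[OF assms(1,2)] by metis
  then have "d z + \<epsilon> *\<^sub>R d v = 0"
    using assms(4)[of "z + \<epsilon> *\<^sub>R v"] by (simp add: linear_add[OF assms(3)] linear_cmul[OF assms(3)])
  then show ?thesis using assms(4)[OF assms(2)] \<open>0 < \<epsilon>\<close> by simp
qed

text \<open>The difference \<open>B\<close> of the two forms satisfies \<open>B (z + \<epsilon>v) + B (z - \<epsilon>v) - 2 B z = 2\<epsilon>\<^sup>2 B v\<close>, and the left
  side vanishes for \<open>z\<close> in \<open>U\<close> and small \<open>\<epsilon>\<close>; so \<open>B\<close> vanishes everywhere and can be polarized.\<close>

lemma quadratic_form_pullback_polarized:
  fixes g g' :: "real^'n::finite^'n"
  assumes "open U" and "z \<in> U" and J: "linear J"
    and sym: "transpose g = g" "transpose g' = g'"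
    and eq: "\<And>z. z \<in> U \<Longrightarrow> z \<bullet> (g *v z) = J z \<bullet> (g' *v J z)"
  shows "x \<bullet> (g *v y) = J x \<bullet> (g' *v J y)"
proof -
  define B where "B x y = x \<bullet> (g *v y) - J x \<bullet> (g' *v J y)" for x y
  have sq: "B (x + c *\<^sub>R y) (x + c *\<^sub>R y) = B x x + 2 * c * B x y + c\<^sup>2 * B y y" for x y c
    using inner_symmetric_matrix[OF sym(1), of x y] inner_symmetric_matrix[OF sym(2), of "J x" "J y"]
    by (simp add: B_def linear_add[OF J] linear_cmul[OF J] matrix_vector_right_distrib matrix_vector_mult_scaleR
        inner_add_left inner_add_right algebra_simps power2_eq_square inner_commute)
  have B0: "B v v = 0" for v
  proof -
    obtain \<epsilon> where e: "0 < \<epsilon>" "z + \<epsilon> *\<^sub>R v \<in> U" "z - \<epsilon> *\<^sub>R v \<in> U"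
      using open_contains_segment[OF assms(1,2)] by metis
    have U0: "B z z = 0" if "z \<in> U" for z using eq[OF that] by (simp add: B_def)
    have "\<epsilon>\<^sup>2 * B v v = 0"
      using sq[of z \<epsilon> v] sq[of z "- \<epsilon>" v] U0[OF e(2)] U0[OF e(3)] U0[OF assms(2)] by simp
    then show ?thesis using e(1) by simp
  qed
  have "B x y = 0" using sq[of x 1 y] by (simp add: B0)
  then show ?thesis by (simp add: B_def)
qed

text \<open>Nondegeneracy of \<open>g\<close> makes the isometry \<open>J\<close> injective, hence bijective; therefore it maps the vector
  that represents \<open>\<omega>\<close> to the vector that represents \<open>\<omega>'\<close>.\<close>

lemma sq_norm_pullback:
  fixes g g' :: "real^'n::finite^'n" and \<omega> \<omega>' :: "real^'n"
  assumes J: "linear J" and inv: "invertible g" "invertible g'"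
    and gJ: "\<And>x y. x \<bullet> (g *v y) = J x \<bullet> (g' *v J y)"
    and \<omega>: "\<And>x. \<omega> \<bullet> x = \<omega>' \<bullet> J x"
  shows "\<omega> \<bullet> (matrix_inv g *v \<omega>) = \<omega>' \<bullet> (matrix_inv g' *v \<omega>')"
proof -
  let ?x = "matrix_inv g *v \<omega>" and ?x' = "matrix_inv g' *v \<omega>'"
  have gx: "g *v ?x = \<omega>" "g' *v ?x' = \<omega>'"
    using matrix_inv_inverse(1)[OF inv(1)] matrix_inv_inverse(1)[OF inv(2)]
    by (simp_all add: matrix_vector_mul_assoc)
  have "inj J"
  proof (rule linear_injective_0[OF J, THEN iffD2], intro allI impI)
    fix y assume "J y = 0"
    then have "(g *v y) \<bullet> (g *v y) = 0" using gJ[of "g *v y" y] by simp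
    then have "matrix_inv g *v (g *v y) = 0" by simp
    then show "y = 0" using matrix_inv_inverse(2)[OF inv(1)] by (simp add: matrix_vector_mul_assoc)
  qed
  then have "surj J" by (rule linear_inj_imp_surj[OF J])
  have "w \<bullet> (g' *v J ?x) = w \<bullet> \<omega>'" for w
  proof -
    obtain y where "w = J y" using \<open>surj J\<close> by (rule surjE)
    then show ?thesis using gJ[of y ?x] \<omega>[of y] by (simp add: gx inner_commute)
  qed
  then have "g' *v J ?x = \<omega>'" by (meson vector_eq_rdot inner_commute vector_eq_ldot)
  then have "J ?x = ?x'"
    using matrix_inv_inverse(2)[OF inv(2)] by (metis matrix_vector_mul_assoc matrix_vector_mul_lid)
  then show ?thesis using \<omega>[of ?x] by simp
qed

lemma quadratic_sq_norm: "sq_norm F y w = w \<bullet> (matrix_inv (g_low F y) *v w)"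
  unfolding sq_norm_def g_up_def by (rule double_sum_eq_inner)

section \<open>Fibres of the tangent bundle in a chart\<close>

locale manifold_atlas =
  fixes X :: "'m topology" and A :: "('m, 'n::finite) chart set"
  assumes manifold: "smooth_manifold X A"
begin

lemma chart_inv_chart:
  assumes "c \<in> A" and "p \<in> fst c"
  shows "chart_inv c (snd c p) = p"
proof -
  have "openin X (fst c)"
    and hom: "homeomorphic_map (subtopology X (fst c)) (top_of_set (chart_image c)) (snd c)"
    using manifold assms(1) by (auto simp: smooth_manifold_def)
  then have "topspace (subtopology X (fst c)) = fst c"
    using openin_subset by (fastforce simp: topspace_subtopology)
  then have "inj_on (snd c) (fst c)"
    using homeomorphic_imp_injective_map[OF hom] by simp
  then show ?thesis using assms(2) by (simp add: chart_inv_def)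
qed

lemma transition_has_derivative:
  assumes "c \<in> A" "c' \<in> A" "p \<in> fst c" "p \<in> fst c'"
  shows "(transition c c' has_derivative frechet_derivative (transition c c') (at (snd c p))) (at (snd c p))"
proof (rule smooth_on_has_derivative)
  show "smooth_on (snd c ` (fst c \<inter> fst c')) (transition c c')"
    using manifold assms(1,2) by (auto simp: smooth_manifold_def)
qed (use assms in auto)

lemma tvec_of_self:
  assumes "c \<in> A" and "p \<in> fst c"
  shows "snd (tvec_of A c p z) c = z"
proof -
  have "open (chart_image c)" using manifold assms(1) by (auto simp: smooth_manifold_def)
  moreover have "transition c c x = x" if "x \<in> chart_image c" for x
    using that chart_inv_chart[OF assms(1)] by (auto simp: transition_def chart_image_def)
  moreover have "snd c p \<in> chart_image c" using assms(2) by (simp add: chart_image_def)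
  ultimately have "(transition c c has_derivative (\<lambda>x. x)) (at (snd c p))"
    using has_derivative_transform_within_open[OF has_derivative_ident] by metis
  from frechet_derivative_at[OF this, symmetric]
  show ?thesis using assms by (simp add: tvec_of_def)
qed

lemma tvec_of_component:
  assumes "v \<in> tangent_bundle A" and "c \<in> A" and "fst v \<in> fst c"
  shows "tvec_of A c (fst v) (snd v c) = v"
proof -
  obtain p w where v: "v = (p, w)" by (cases v)
  have "(if c' \<in> A \<and> p \<in> fst c' then frechet_derivative (transition c c') (at (snd c p)) (w c) else 0) = w c'" for c'
  proof (cases "c' \<in> A \<and> p \<in> fst c'")
    case True
    have "\<forall>c\<in>A. \<forall>c'\<in>A. p \<in> fst c \<longrightarrow> p \<in> fst c' \<longrightarrow>
        w c' = frechet_derivative (transition c c') (at (snd c p)) (w c)"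
      using assms(1) unfolding tangent_bundle_def v mem_Collect_eq case_prod_conv by (elim conjE)
    then have "w c' = frechet_derivative (transition c c') (at (snd c p)) (w c)"
      using True assms(2,3) unfolding v fst_conv by blast
    then show ?thesis unfolding if_P[OF True] by (rule sym)
  next
    case False
    have "\<forall>c. \<not> (c \<in> A \<and> p \<in> fst c) \<longrightarrow> w c = 0"
      using assms(1) unfolding tangent_bundle_def v mem_Collect_eq case_prod_conv by (elim conjE)
    from spec[OF this, of c'] have "w c' = 0" by (rule mp) (rule False)
    then show ?thesis unfolding if_not_P[OF False] by (rule sym)
  qed
  then show ?thesis by (simp add: tvec_of_def v)
qed

end

locale conic_fibre = manifold_atlas X A
  for X :: "'m topology" and A :: "('m, 'n::finite) chart set" +
  fixes D :: "('m, 'n) tvec set" and c :: "('m, 'n) chart" and p :: 'm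
  assumes conic: "conic_domain A D" and c: "c \<in> A" and p: "p \<in> fst c"
begin

definition U :: "(real^'n) set" where "U = {z. tvec_of A c p z \<in> D}"

lemma U_coord_domain: "z \<in> U \<longleftrightarrow> (snd c p, z) \<in> coord_domain A c D"
  using p chart_inv_chart[OF c p] by (simp add: U_def coord_domain_def chart_image_def)

lemma open_coord_domain: "open (coord_domain A c D)"
  using conic c by (auto simp: conic_domain_def)

lemma open_U: "open U"
proof -
  have "open ((\<lambda>z. (snd c p, z)) -` coord_domain A c D)"
    by (intro open_vimage open_coord_domain continuous_intros)
  also have "(\<lambda>z. (snd c p, z)) -` coord_domain A c D = U"
    using U_coord_domain by auto
  finally show ?thesis .
qed

lemma tvec_of_scaleR: "tvec_of A c p (k *\<^sub>R z) = (p, \<lambda>c'. k *\<^sub>R snd (tvec_of A c p z) c')"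
  using linear_cmul[OF has_derivative_linear[OF transition_has_derivative[OF c _ p]]]
  by (auto simp: tvec_of_def fun_eq_iff)

lemma fst_tvec_of [simp]: "fst (tvec_of A c p z) = p"
  by (simp add: tvec_of_def)

lemma cone_U:
  assumes "z \<in> U" and "0 < k"
  shows "k *\<^sub>R z \<in> U"
proof -
  have "(p, snd (tvec_of A c p z)) \<in> D" using assms(1) by (simp add: U_def tvec_of_def)
  then show ?thesis
    using conic assms(2) by (auto simp: U_def tvec_of_scaleR conic_domain_def)
qed

lemma D_tangent: "D \<subseteq> tangent_bundle A"
  using conic by (auto simp: conic_domain_def slit_tangent_bundle_def)

lemma component_in_U: "v \<in> D \<Longrightarrow> fst v = p \<Longrightarrow> snd v c \<in> U"
  using tvec_of_component[of v c] D_tangent c p by (auto simp: U_def)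

end

text \<open>The vector \<open>z0\<close> witnesses that the metric is defined somewhere in this fibre, and it serves to name
  the constant value \<open>g\<close> of the metric tensor there.\<close>

locale riemannian_fibre = conic_fibre X A D c p
  for X :: "'m topology" and A :: "('m, 'n::finite) chart set" and D c p +
  fixes L :: "('m, 'n) tvec \<Rightarrow> real" and z0 :: "real^'n"
  assumes riem: "riemannian A D L" and z0: "tvec_of A c p z0 \<in> D"
begin

definition F :: "real^'n \<Rightarrow> real" where "F = fibre A c L p"
definition g :: "real^'n^'n" where "g = g_low F z0"

lemma finsler: "finsler A D L" using riem by (simp add: riemannian_def)

lemma z0_U: "z0 \<in> U" using z0 by (simp add: U_def)

lemma F_pos: "z \<in> U \<Longrightarrow> 0 < F z"
  using finsler by (simp add: finsler_def F_def fibre_def U_def)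

lemma F_hom: "z \<in> U \<Longrightarrow> 0 < k \<Longrightarrow> F (k *\<^sub>R z) = k * F z"
proof -
  assume "z \<in> U" and k: "0 < k"
  then have "(p, snd (tvec_of A c p z)) \<in> D" by (simp add: U_def tvec_of_def)
  moreover have "\<forall>(p, v)\<in>D. \<forall>k>0. L (p, \<lambda>c. k *\<^sub>R v c) = k * L (p, v)"
    using finsler unfolding finsler_def by (elim conjE)
  ultimately have "L (p, \<lambda>c'. k *\<^sub>R snd (tvec_of A c p z) c') = k * L (p, snd (tvec_of A c p z))"
    using k by blast
  also have "(p, snd (tvec_of A c p z)) = tvec_of A c p z" by (simp add: tvec_of_def)
  finally show ?thesis by (simp add: F_def fibre_def tvec_of_scaleR)
qed

lemma g_low_F:
  assumes "z \<in> U"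
  shows "g_low F z = g"
proof -
  have "g_low F (snd (tvec_of A c p z) c) = g_low F (snd (tvec_of A c p z0) c)"
    unfolding F_def using riem assms z0 c p
    by (simp add: riemannian_def U_def) (metis fst_tvec_of)
  then show ?thesis by (simp add: tvec_of_self[OF c p] g_def)
qed

lemma invertible_g: "invertible g"
proof -
  have "\<forall>v\<in>D. \<forall>c\<in>A. fst v \<in> fst c \<longrightarrow> invertible (g_low (fibre A c L (fst v)) (snd v c))"
    using finsler unfolding finsler_def by (elim conjE)
  from bspec[OF bspec[OF this z0] c] show ?thesis
    using p by (simp add: g_def F_def tvec_of_self[OF c p])
qed

lemma F_differentiable:
  assumes "z \<in> U"
  shows "F differentiable (at z)" and "pd j F differentiable (at z)"
proof -
  have "smooth_on (coord_domain A c D) (coord_rep A c L)"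
    using finsler c by (auto simp: finsler_def)
  moreover have "F = (\<lambda>z. coord_rep A c L (snd c p, z))"
    using chart_inv_chart[OF c p] by (simp add: F_def coord_rep_def)
  ultimately show "F differentiable (at z)" and "pd j F differentiable (at z)"
    using smooth_on_slice[OF _ open_coord_domain] assms U_coord_domain by auto
qed

lemma F_square: "z \<in> U \<Longrightarrow> (F z)\<^sup>2 = z \<bullet> (g *v z)" and g_sym: "transpose g = g"
proof -
  have pd_sq: "pd j (\<lambda>z. (F z)\<^sup>2) z = 2 * F z * pd j F z" if "z \<in> U" for z j
  proof -
    obtain F' where F': "(F has_derivative F') (at z)"
      using F_differentiable(1)[OF \<open>z \<in> U\<close>] by (auto simp: differentiable_def)
    from has_derivative_along_line[OF F', of "axis j 1"]
    have "((\<lambda>s. F (z + s *\<^sub>R axis j 1)) has_real_derivative pd j F z) (at 0)"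
      by (simp add: pd_has_derivative[OF F'])
    from DERIV_power[OF this, of 2] show ?thesis
      by (intro pd_eqI) (simp add: mult_ac)
  qed
  have d2: "pd j (\<lambda>z. (F z)\<^sup>2) differentiable (at z)" if "z \<in> U" for z j
  proof -
    have "(\<lambda>z. 2 * F z * pd j F z) differentiable (at z)"
      using F_differentiable[OF that] by (intro differentiable_mult) auto
    then obtain P where "((\<lambda>z. 2 * F z * pd j F z) has_derivative P) (at z)"
      by (auto simp: differentiable_def)
    then have "(pd j (\<lambda>z. (F z)\<^sup>2) has_derivative P) (at z)"
      by (rule has_derivative_transform_within_open[OF _ open_U that]) (simp add: pd_sq)
    then show ?thesis by (rule differentiableI)
  qed
  have hess: "pd i (pd j (\<lambda>z. (F z)\<^sup>2)) z = 2 * g $ i $ j" if "z \<in> U" for z i j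
  proof -
    have "g $ i $ j = 1/2 * pd i (pd j (\<lambda>z. (F z)\<^sup>2)) z"
      unfolding g_low_F[OF that, symmetric] by (simp add: g_low_def)
    then show ?thesis by simp
  qed
  have d1: "(\<lambda>z. (F z)\<^sup>2) differentiable (at z)" if "z \<in> U" for z
    using F_differentiable(1)[OF that] by simp
  have hom: "(F (k *\<^sub>R z))\<^sup>2 = k\<^sup>2 * (F z)\<^sup>2" if "z \<in> U" "0 < k" for z k
    by (simp add: F_hom[OF that] power_mult_distrib)
  note q = constant_hessian_imp_quadratic_form[where q = "\<lambda>z. (F z)\<^sup>2", OF open_U cone_U hom d1 d2 hess]
  show "z \<in> U \<Longrightarrow> (F z)\<^sup>2 = z \<bullet> (g *v z)" by (rule q(1))
  show "transpose g = g" by (rule q(2)) (assumption | rule z0_U)+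
qed

lemma F_eq_sqrt: "z \<in> U \<Longrightarrow> sqrt (z \<bullet> (g *v z)) = F z"
  using F_pos[of z] by (simp add: F_square[symmetric])

end

section \<open>Coefficients of the change and independence of the chart\<close>

text \<open>The dictionary between the coefficients of the change and the functions of \<open>\<tau>\<close> used in a fibre. The
  factor \<open>e\<^sup>2\<^sup>\<sigma>\<close> in the last argument of \<open>lambda_coef\<close> converts \<open>m\<^sup>2\<close> from the conformal metric to the
  original one.\<close>

lemma (in homogeneous_function) coef_formulas:
  fixes s l b :: real
  defines "u \<equiv> exp s * l"
  defines "\<tau> \<equiv> b / u"
  assumes \<Omega>: "(u, b) \<in> \<Omega>" and l: "0 < l" and f0: "f 1 \<tau> \<noteq> 0"
  defines "a \<equiv> f 1 \<tau> * (f 1 \<tau> - \<tau> * D2 f 1 \<tau>)"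
    and "q \<equiv> f 1 \<tau> * D2 (D2 f) 1 \<tau>"
    and "a' \<equiv> f 1 \<tau> * D2 f 1 \<tau> - \<tau> * ((D2 f 1 \<tau>)\<^sup>2 + f 1 \<tau> * D2 (D2 f) 1 \<tau>)"
    and "c' \<equiv> 3 * D2 f 1 \<tau> * D2 (D2 f) 1 \<tau> + f 1 \<tau> * D2 (D2 (D2 f)) 1 \<tau>"
  shows "p_coef f s l b = exp s * a" and "q0_coef f s l b = q"
    and "pm1_coef f s l b = a' / l"
    and "a \<noteq> 0 \<Longrightarrow> a + q * \<mu> \<noteq> 0 \<Longrightarrow> lambda_coef n f s l b ((exp s)\<^sup>2 * \<mu>)
      = (real n + 1) * a' / (2 * u * a) - 3 * a' * q * \<mu> / (2 * u * a * (a + q * \<mu>))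
        + c' * \<mu> / (2 * u * (a + q * \<mu>))"
proof -
  have u: "0 < u" using l by (simp add: u_def)
  note eqs = f_eq[OF \<Omega> u] D1_eq[OF \<Omega> u] D2_eq[OF \<Omega> u] D22_eq[OF \<Omega> u] D2_D1_eq[OF \<Omega> u] D2_p0_eq[OF \<Omega> u]
  show p: "p_coef f s l b = exp s * a"
    using l unfolding p_coef_def u_def[symmetric] eqs \<tau>_def[symmetric] a_def
    by (simp add: u_def field_simps)
  show q: "q0_coef f s l b = q"
    using u unfolding q0_coef_def u_def[symmetric] eqs \<tau>_def[symmetric] q_def by simp
  show pm1: "pm1_coef f s l b = a' / l"
    using u l f0 unfolding pm1_coef_def p u_def[symmetric] eqs \<tau>_def[symmetric] a_def a'_def
    by (simp add: u_def field_simps power2_eq_square)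
  have p02: "p02_coef f s l b = c' / u"
    unfolding p02_coef_def u_def[symmetric] eqs \<tau>_def[symmetric] c'_def ..
  let ?k = "exp s"
  assume a: "a \<noteq> 0" and N: "a + q * \<mu> \<noteq> 0"
  have kN: "?k * (?k * a) + q * (?k\<^sup>2 * \<mu>) = ?k\<^sup>2 * (a + q * \<mu>)"
    by (simp add: power2_eq_square algebra_simps)
  have kN': "?k * (?k * a) + ?k\<^sup>2 * \<mu> * q = ?k\<^sup>2 * (a + q * \<mu>)"
    by (simp add: power2_eq_square algebra_simps)
  have s0: "s0_coef f s l b (?k\<^sup>2 * \<mu>) = q / (?k * (?k * a * (?k\<^sup>2 * (a + q * \<mu>))))"
    unfolding s0_coef_def p q kN' by (simp add: exp_minus field_simps)
  have "(real n + 1) * (a' / l) / (2 * (?k * a)) = (real n + 1) * a' / (2 * u * a)"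
    using l by (simp add: u_def)
  moreover have "3 * ?k * (a' / l) * (?k\<^sup>2 * \<mu>) * (q / (?k * (?k * a * (?k\<^sup>2 * (a + q * \<mu>))))) / 2
      = 3 * a' * q * \<mu> / (2 * u * a * (a + q * \<mu>))"
    by (simp add: u_def power2_eq_square mult_ac)
  moreover have "c' / u * (?k\<^sup>2 * \<mu>) / (2 * (?k\<^sup>2 * (a + q * \<mu>))) = c' * \<mu> / (2 * u * (a + q * \<mu>))"
    by (simp add: u_def power2_eq_square)
  ultimately show "lambda_coef n f s l b ((exp s)\<^sup>2 * \<mu>)
      = (real n + 1) * a' / (2 * u * a) - 3 * a' * q * \<mu> / (2 * u * a * (a + q * \<mu>))
        + c' * \<mu> / (2 * u * (a + q * \<mu>))"
    unfolding lambda_coef_def p pm1 s0 p02 q kN by (simp only:)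
qed

lemma (in riemannian_fibre) m_low_component:
  assumes "v \<in> D" and "fst v = p"
  shows "m_low A c \<beta> L v = form_comp A c \<beta> p - (\<beta> v / (L v)\<^sup>2) *\<^sub>R (g *v snd v c)"
  using g_low_F[OF component_in_U[OF assms]] assms(2)
  by (simp add: vec_eq_iff m_low_def y_low_def F_def matrix_vector_mult_def)

lemma (in riemannian_fibre) m_sq_formula:
  assumes "v \<in> D" and "fst v = p"
  shows "m_sq A c \<beta> L v = m_low A c \<beta> L v \<bullet> (matrix_inv g *v m_low A c \<beta> L v)"
  using g_low_F[OF component_in_U[OF assms]] assms(2)
  by (simp add: m_sq_def quadratic_sq_norm F_def)

text \<open>\<open>L\<close> and \<open>\<beta>\<close> are functions on the tangent bundle, so the Jacobian \<open>J\<close> of the transition map intertwines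
  their expressions in the two charts, at first only on the open set where \<open>L\<close> is defined. That is
  enough to make \<open>J\<close> an isometry which pulls \<open>\<beta>\<close>, and hence \<open>m\<close>, back.\<close>

lemma (in manifold_atlas) m_sq_chart_invariant:
  assumes riem: "riemannian A D L" and form: "smooth_one_form A \<beta>" and "v \<in> D"
    and c: "c \<in> A" "fst v \<in> fst c" and c': "c' \<in> A" "fst v \<in> fst c'"
  shows "m_sq A c \<beta> L v = m_sq A c' \<beta> L v"
proof -
  let ?p = "fst v" and ?y = "snd v c" and ?y' = "snd v c'"
  have conic: "conic_domain A D" using riem by (simp add: riemannian_def finsler_def)
  then have vT: "v \<in> tangent_bundle A"
    using \<open>v \<in> D\<close> by (auto simp: conic_domain_def slit_tangent_bundle_def)
  interpret R: riemannian_fibre X A D c ?p L ?y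
    using conic riem c \<open>v \<in> D\<close> tvec_of_component[OF vT c]
    by unfold_locales auto
  interpret R': riemannian_fibre X A D c' ?p L ?y'
    using conic riem c' \<open>v \<in> D\<close> tvec_of_component[OF vT c']
    by unfold_locales auto
  define J where "J = frechet_derivative (transition c c') (at (snd c ?p))"
  have J: "linear J"
    unfolding J_def by (rule has_derivative_linear[OF transition_has_derivative[OF c(1) c'(1) c(2) c'(2)]])
  have tvec: "tvec_of A c' ?p (J z) = tvec_of A c ?p z" if "z \<in> R.U" for z
  proof -
    have "tvec_of A c ?p z \<in> tangent_bundle A" using that R.D_tangent by (auto simp: R.U_def)
    from tvec_of_component[OF this c'(1)] show ?thesis
      using c' by (simp add: J_def) (simp add: tvec_of_def)
  qed
  have JU: "J z \<in> R'.U" if "z \<in> R.U" for z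
    using that tvec[OF that] by (simp add: R.U_def R'.U_def)
  have yU: "?y \<in> R.U" by (rule R.component_in_U[OF \<open>v \<in> D\<close> refl])
  have y': "?y' = J ?y"
    using arg_cong[OF tvec_of_component[OF vT c], of "\<lambda>w. snd w c'"] c' by (simp add: tvec_of_def J_def)
  have g: "x \<bullet> (R.g *v y) = J x \<bullet> (R'.g *v J y)" for x y
  proof (rule quadratic_form_pullback_polarized[OF R.open_U yU J R.g_sym R'.g_sym])
    fix z assume z: "z \<in> R.U"
    have "R.F z = R'.F (J z)" by (simp add: R.F_def R'.F_def fibre_def tvec[OF z])
    then show "z \<bullet> (R.g *v z) = J z \<bullet> (R'.g *v J z)"
      using R.F_square[OF z] R'.F_square[OF JU[OF z]] by simp
  qed
  let ?b = "form_comp A c \<beta> ?p" and ?b' = "form_comp A c' \<beta> ?p"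
  have \<beta>: "\<beta> (tvec_of A c ?p z) = ?b \<bullet> z" "\<beta> (tvec_of A c' ?p z) = ?b' \<bullet> z" for z
    using form c c' by (simp_all add: smooth_one_form_def fibre_def inner_vec_def)
  have "?b \<bullet> x - ?b' \<bullet> J x = 0" for x
  proof (rule linear_eq_on_open[where d = "\<lambda>x. ?b \<bullet> x - ?b' \<bullet> J x", OF R.open_U yU])
    show "linear (\<lambda>x. ?b \<bullet> x - ?b' \<bullet> J x)"
      by (rule linearI) (simp_all add: linear_add[OF J] linear_cmul[OF J] inner_add_right algebra_simps)
    show "?b \<bullet> z - ?b' \<bullet> J z = 0" if "z \<in> R.U" for z
      using \<beta>(1)[of z] \<beta>(2)[of "J z"] tvec[OF that] by simp
  qed
  then have "m_low A c \<beta> L v \<bullet> x = m_low A c' \<beta> L v \<bullet> J x" for x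
    using g[of x ?y]
    by (simp add: R.m_low_component[OF \<open>v \<in> D\<close>] R'.m_low_component[OF \<open>v \<in> D\<close>] y'
        inner_diff_left inner_diff_right inner_commute)
  from sq_norm_pullback[OF J R.invertible_g R'.invertible_g g this]
  show ?thesis
    by (simp add: R.m_sq_formula[OF \<open>v \<in> D\<close>] R'.m_sq_formula[OF \<open>v \<in> D\<close>])
qed

text \<open>\<open>semi_C_reducible_fibre\<close> for the conformal metric \<open>G = e\<^sup>2\<^sup>\<sigma> g\<close>, translated back to \<open>g\<close>.\<close>

lemma semi_C_reducible_at:
  fixes A :: "('m, 'n::finite) chart set"
  assumes M: "smooth_manifold X A" and riem: "riemannian A D L"
    and change: "gen_beta_conformal_change A D \<Omega> f \<sigma> \<beta> L"
    and v: "v \<in> D" and c: "c \<in> A" "fst v \<in> fst c"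
    and reg: "regular_point A c f \<sigma> \<beta> L v"
    and lam: "lambda_coef CARD('n) f (\<sigma> (fst v)) (L v) (\<beta> v) (m_sq A c \<beta> L v) \<noteq> 0"
    and r: "r = (real CARD('n) + 1) * pm1_coef f (\<sigma> (fst v)) (L v) (\<beta> v)
      / (2 * p_coef f (\<sigma> (fst v)) (L v) (\<beta> v)
          * lambda_coef CARD('n) f (\<sigma> (fst v)) (L v) (\<beta> v) (m_sq A c \<beta> L v))"
    and F: "F = fibre A c (L_bar f \<sigma> \<beta> L) (fst v)" and y: "y = snd v c"
  shows "C_sq F y \<noteq> 0"
    and "C_low F y i j k = r / (real CARD('n) + 1)
        * (h_low F y $ i $ j * C_vec F y $ k + h_low F y $ k $ i * C_vec F y $ j
           + h_low F y $ j $ k * C_vec F y $ i)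
      + (1 - r) / C_sq F y * C_vec F y $ i * C_vec F y $ j * C_vec F y $ k"
proof -
  let ?p = "fst v"
  interpret manifold_atlas X A using M by unfold_locales
  have conic: "conic_domain A D" using riem by (simp add: riemannian_def finsler_def)
  then have vT: "v \<in> tangent_bundle A"
    using v by (auto simp: conic_domain_def slit_tangent_bundle_def)
  have vy: "tvec_of A c ?p y = v" unfolding y by (rule tvec_of_component[OF vT c])
  interpret R: riemannian_fibre X A D c ?p L y
    using conic riem c v vy by unfold_locales auto
  interpret homogeneous_function \<Omega> f
    using change by unfold_locales (simp add: gen_beta_conformal_change_def)
  define s \<kappa> b where "s = \<sigma> ?p" and "\<kappa> = exp s" and "b = form_comp A c \<beta> ?p"
  have \<kappa>: "0 < \<kappa>" by (simp add: \<kappa>_def)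
  have yU: "y \<in> R.U" using v vy by (simp add: R.U_def)
  have \<beta>: "\<beta> (tvec_of A c ?p z) = b \<bullet> z" for z
    using change c by (simp add: gen_beta_conformal_change_def smooth_one_form_def fibre_def inner_vec_def b_def)
  have in_\<Omega>: "(\<kappa> * R.F z, b \<bullet> z) \<in> \<Omega>" if "z \<in> R.U" for z
  proof -
    have "\<forall>v\<in>D. (exp (\<sigma> (fst v)) * L v, \<beta> v) \<in> \<Omega>"
      using change by (simp add: gen_beta_conformal_change_def)
    from bspec[OF this, of "tvec_of A c ?p z"] that show ?thesis
      by (simp add: R.U_def R.F_def fibre_def \<beta> \<kappa>_def s_def)
  qed
  define G where "G = \<kappa>\<^sup>2 *\<^sub>R R.g"
  have Gz: "G *v z = \<kappa>\<^sup>2 *\<^sub>R (R.g *v z)" for z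
    by (simp add: G_def scaleR_matrix_vector_assoc)
  have sqrt_G: "sqrt (z \<bullet> (G *v z)) = \<kappa> * R.F z" if "z \<in> R.U" for z
    using R.F_eq_sqrt[OF that] \<kappa> by (simp add: Gz real_sqrt_mult)
  have u_pos: "0 < \<kappa> * R.F z" if "z \<in> R.U" for z using \<kappa> R.F_pos[OF that] by simp
  interpret B: beta_change_of_quadratic R.U G b "f 1" "D2 f 1" "D2 (D2 f) 1" "D2 (D2 (D2 f)) 1" T F
  proof
    show "transpose G = G" using R.g_sym by (simp add: G_def transpose_def vec_eq_iff)
    show "0 < z \<bullet> (G *v z)" if "z \<in> R.U" for z
      using R.F_pos[OF that] \<kappa> by (simp add: Gz R.F_square[OF that, symmetric])
    show "b \<bullet> z / sqrt (z \<bullet> (G *v z)) \<in> T" if "z \<in> R.U" for z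
      unfolding sqrt_G[OF that] by (rule slope_in_T[OF in_\<Omega>[OF that] u_pos[OF that]])
    show "F z = sqrt (z \<bullet> (G *v z)) * f 1 (b \<bullet> z / sqrt (z \<bullet> (G *v z)))" if "z \<in> R.U" for z
      unfolding sqrt_G[OF that] f_eq[OF in_\<Omega>[OF that] u_pos[OF that], symmetric]
      by (simp add: F fibre_def L_bar_def \<beta> R.F_def \<kappa>_def s_def)
  qed (fact R.open_U T_der)+
  have Fy: "R.F y = L v" by (simp add: R.F_def fibre_def vy)
  have b_y: "b \<bullet> y = \<beta> v" using \<beta>[of y] by (simp add: vy)
  have l: "0 < L v" using R.F_pos[OF yU] by (simp add: Fy)
  have u: "B.u y = \<kappa> * L v" by (simp add: B.u_def sqrt_G[OF yU] Fy)
  have \<tau>: "B.\<tau> y = \<beta> v / (\<kappa> * L v)" by (simp add: B.\<tau>_def u b_y)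
  have bar: "finsler A D (L_bar f \<sigma> \<beta> L)"
    using change by (simp add: gen_beta_conformal_change_def)
  have "\<forall>v\<in>D. \<forall>c\<in>A. fst v \<in> fst c \<longrightarrow>
      invertible (g_low (fibre A c (L_bar f \<sigma> \<beta> L) (fst v)) (snd v c))"
    using bar unfolding finsler_def by (elim conjE)
  from bspec[OF bspec[OF this v] c(1)] have inv: "invertible (g_low F y)"
    using c(2) by (simp add: F y)
  have F_nz: "F y \<noteq> 0"
    using bar v by (force simp: finsler_def F fibre_def vy)
  have f_nz: "f 1 (\<beta> v / (exp s * L v)) \<noteq> 0"
    using F_nz B.Fb[OF yU] by (simp add: sqrt_G[OF yU] Fy b_y \<kappa>_def)
  have m: "B.m y = m_low A c \<beta> L v"
    using \<kappa> l by (simp add: R.m_low_component[OF v refl] B.m_def B.Y_def Gz \<tau> u y[symmetric] b_def[symmetric] power2_eq_square)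
  let ?m2 = "m_sq A c \<beta> L v"
  define \<zeta> where "\<zeta> = (1 / \<kappa>\<^sup>2) *\<^sub>R (matrix_inv R.g *v B.m y)"
  have "R.g *v (matrix_inv R.g *v x) = x" for x
    by (simp add: matrix_vector_mul_assoc matrix_inv_inverse(1)[OF R.invertible_g])
  then have \<zeta>: "G *v \<zeta> = B.m y"
    using \<kappa> by (simp add: Gz \<zeta>_def matrix_vector_mult_scaleR del: matrix_vector_mul_assoc)
  define \<mu> where "\<mu> = B.m y \<bullet> \<zeta>"
  have m2: "?m2 = (exp s)\<^sup>2 * \<mu>"
    using \<kappa> by (simp add: \<mu>_def \<zeta>_def R.m_sq_formula[OF v refl] m \<kappa>_def)
  have "(exp s * L v, \<beta> v) \<in> \<Omega>" using in_\<Omega>[OF yU] by (simp add: Fy b_y \<kappa>_def)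
  note co = coef_formulas[OF this l f_nz, folded \<kappa>_def, folded \<tau>, folded B.a0_def B.a1_def B.c1_def, folded u]
  let ?q = "f 1 (B.\<tau> y) * D2 (D2 f) 1 (B.\<tau> y)"
  have "?m2 \<noteq> 0" and p: "p_coef f s (L v) (\<beta> v) \<noteq> 0"
    and N: "exp s * p_coef f s (L v) (\<beta> v) + ?m2 * q0_coef f s (L v) (\<beta> v) \<noteq> 0"
    using reg by (simp_all add: regular_point_def Let_def s_def)
  then have \<mu>_nz: "\<mu> \<noteq> 0" by (simp add: m2)
  have a: "B.a0 (B.\<tau> y) \<noteq> 0" using p by (simp add: co(1))
  have "exp s * p_coef f s (L v) (\<beta> v) + ?m2 * q0_coef f s (L v) (\<beta> v) = \<kappa>\<^sup>2 * (B.a0 (B.\<tau> y) + ?q * \<mu>)"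
    unfolding m2 co(1) co(2) by (simp add: \<kappa>_def power2_eq_square algebra_simps)
  then have N': "B.a0 (B.\<tau> y) + ?q * \<mu> \<noteq> 0" using N by auto
  have lambda: "lambda_coef CARD('n) f s (L v) (\<beta> v) ?m2 = B.mean_coef y \<mu>"
    unfolding m2 B.mean_coef_def \<kappa>_def[symmetric] by (rule co(4)[OF a N'])
  have lam': "B.mean_coef y \<mu> \<noteq> 0" using lam unfolding s_def[symmetric] lambda .
  have r': "r = (real CARD('n) + 1) * B.a1 (B.\<tau> y) / (2 * B.u y * B.a0 (B.\<tau> y) * B.mean_coef y \<mu>)"
    unfolding r s_def[symmetric] lambda co(1) co(3) u using l by simp
  note res = B.semi_C_reducible_fibre[OF yU inv F_nz \<zeta> a \<mu>_def \<mu>_nz N' lam' r']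
  show "C_sq F y \<noteq> 0" by (rule res(1))
  show "C_low F y i j k = r / (real CARD('n) + 1)
        * (h_low F y $ i $ j * C_vec F y $ k + h_low F y $ k $ i * C_vec F y $ j
           + h_low F y $ j $ k * C_vec F y $ i)
      + (1 - r) / C_sq F y * C_vec F y $ i * C_vec F y $ j * C_vec F y $ k"
    by (rule res(2))
qed

theorem theorem2p8:
  fixes X :: "'m topology"
    and A :: "('m, 'n::finite) chart set"
    and D E :: "('m, 'n) tvec set"
    and L \<beta> :: "('m, 'n) tvec \<Rightarrow> real"
    and \<sigma> :: "'m \<Rightarrow> real"
    and f :: "real \<Rightarrow> real \<Rightarrow> real"
    and \<Omega> :: "(real \<times> real) set"
  assumes "smooth_manifold X A"
    and "3 \<le> CARD('n)"
    and "riemannian A D L"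
    and "gen_beta_conformal_change A D \<Omega> f \<sigma> \<beta> L"
    and "E \<subseteq> D"
    and "\<And>v c. v \<in> E \<Longrightarrow> c \<in> A \<Longrightarrow> fst v \<in> fst c \<Longrightarrow> regular_point A c f \<sigma> \<beta> L v"
    and "\<And>v c. v \<in> E \<Longrightarrow> c \<in> A \<Longrightarrow> fst v \<in> fst c \<Longrightarrow>
           lambda_coef CARD('n) f (\<sigma> (fst v)) (L v) (\<beta> v) (m_sq A c \<beta> L v) \<noteq> 0"
  shows "semi_C_reducible A E (L_bar f \<sigma> \<beta> L)"
proof -
  interpret manifold_atlas X A using assms(1) by unfold_locales
  \<comment> \<open>\<open>r\<close> is a function on the tangent bundle, so it is defined with an arbitrary chart.\<close>
  define m2 where "m2 v = m_sq A (SOME c. c \<in> A \<and> fst v \<in> fst c) \<beta> L v" for v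
  define r where "r v = (real CARD('n) + 1) * pm1_coef f (\<sigma> (fst v)) (L v) (\<beta> v)
      / (2 * p_coef f (\<sigma> (fst v)) (L v) (\<beta> v)
          * lambda_coef CARD('n) f (\<sigma> (fst v)) (L v) (\<beta> v) (m2 v))" for v
  have form: "smooth_one_form A \<beta>" using assms(4) by (simp add: gen_beta_conformal_change_def)
  have m2: "m2 v = m_sq A c \<beta> L v" if "v \<in> E" "c \<in> A" "fst v \<in> fst c" for v c
  proof -
    have "\<exists>c. c \<in> A \<and> fst v \<in> fst c" using that by blast
    from someI_ex[OF this] show ?thesis
      unfolding m2_def using that assms(5) by (intro m_sq_chart_invariant[OF assms(3) form]) auto
  qed
  show ?thesis
    unfolding semi_C_reducible_def Let_def
  proof (rule conjI[OF assms(2)], rule exI[of _ r], rule exI[of _ "\<lambda>v. 1 - r v"],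
      intro conjI ballI impI allI)
    fix v c assume v: "v \<in> E" and c: "c \<in> A" "fst v \<in> fst c"
    note at = semi_C_reducible_at[OF assms(1,3,4) subsetD[OF assms(5) v] c assms(6)[OF v c] assms(7)[OF v c]
        r_def[of v, unfolded m2[OF v c]] refl refl]
    show "C_sq (fibre A c (L_bar f \<sigma> \<beta> L) (fst v)) (snd v c) \<noteq> 0" by (rule at(1))
  next
    fix v c i j k assume v: "v \<in> E" and c: "c \<in> A" "fst v \<in> fst c"
    note at = semi_C_reducible_at[OF assms(1,3,4) subsetD[OF assms(5) v] c assms(6)[OF v c] assms(7)[OF v c]
        r_def[of v, unfolded m2[OF v c]] refl refl]
    let ?F = "fibre A c (L_bar f \<sigma> \<beta> L) (fst v)" and ?y = "snd v c"
    show "C_low ?F ?y i j k = r v / (real CARD('n) + 1)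
        * (h_low ?F ?y $ i $ j * C_vec ?F ?y $ k + h_low ?F ?y $ k $ i * C_vec ?F ?y $ j
           + h_low ?F ?y $ j $ k * C_vec ?F ?y $ i)
      + (1 - r v) / C_sq ?F ?y * C_vec ?F ?y $ i * C_vec ?F ?y $ j * C_vec ?F ?y $ k"
      by (rule at(2))
  qed simp
qed

end
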